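(* Let $n\ge 2$, $j\ge 1$, $j\not\equiv 0 \pmod n$. Let $\gamma\in\mathcal{M}_n(\mathbb{R})$, and let $g=(\gamma,\gamma_x,\ldots,\gamma_x^{(n-1)})$ and $u$ be its central affine moving frame and central affine curvature. Then $\xi(\gamma)=g\,Z_{j,0}(u)\,e_1$ is tangent to $\mathcal{M}_n(\mathbb{R})$ at $\gamma$. Consequently $\gamma_t=g\,Z_{j,0}(u)\,e_1$ is a flow equation on $\mathcal{M}_n(\mathbb{R})$ (called the $j$-th central affine curve flow).
   Context: $\mathcal{M}_n(\mathbb{R})$ is the set of smooth $\gamma:\mathbb{R}\to\mathbb{R}^n\setminus\{0\}$ with $\det(\gamma,\gamma_x,\ldots,\gamma_x^{(n-1)})=1$, where $\gamma_x^{(i)}=d^i\gamma/dx^i$. For such $\gamma$ the frame $g=(\gamma,\ldots,\gamma_x^{(n-1)})$ satisfies $g_x=g(b+u)$ with $b=\sum_{i=1}^{n-1}e_{i+1,i}$ and $u=\sum_{i=1}^{n-1}u_ie_{in}$, where $\gamma_x^{(n)}=u_1\gamma+\cdots+u_{n-1}\gamma_x^{(n-2)}$; $u$ is the central affine curvature. $V_n=\bigoplus_{i=1}^{n-1}\mathbb{R}e_{in}$, $e_1=(1,0,\ldots,0)^t$. A smooth $X:\mathbb{R}\to\mathbb{R}^n$ is tangent to $\mathcal{M}_n(\mathbb{R})$ at $\gamma$ iff $\sum_{i=0}^{n-1}\det(\gamma,\ldots,\gamma_x^{(i-1)},X_x^{(i)},\gamma_x^{(i+1)},\ldots,\gamma_x^{(n-1)})=0$.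 Let $J=e_{1n}\lambda+b$. For smooth $u:\mathbb{R}\to V_n$, let $Y(u,\lambda)=e_{1n}\lambda+\sum_{i\le 0}Y_{1,i}(u)\lambda^i$ be the unique formal series with smooth $sl(n)$-valued coefficients satisfying $Y_x+[J+u,Y]=0$ and $Y^n=\lambda I_n$; its coefficients are differential polynomials in $u$. Write $Y(u,\lambda)^j=\sum_i Y_{j,i}(u)\lambda^i$. There is a unique $\zeta_j(u)$ with values in the strictly upper triangular matrices (entries differential polynomials in $u$) such that $[\partial_x+b+u,\,Y_{j,0}(u)-\zeta_j(u)]\in V_n$, where $[\partial_x+A,B]=B_x+[A,B]$. Set $Z_{j,0}(u)=Y_{j,0}(u)-\zeta_j(u)$. *)

theory Defs
  imports
    "HOL-Analysis.Derivative"
    "HOL-Computational_Algebra.Formal_Laurent_Series"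
    "Jordan_Normal_Form.Determinant"
begin

text \<open>Matrices and vectors are indexed from 0, so that the \<open>(i,k)\<close> entry of the
  mathematical text is the entry \<open>(i - 1, k - 1)\<close> here. Curves in \<open>\<real>\<^sup>n\<close> and matrix-valued
  functions of \<open>x\<close> are differentiated entrywise.\<close>

definition smooth_fun :: "(real \<Rightarrow> real) \<Rightarrow> bool" where
  "smooth_fun f \<longleftrightarrow> (\<forall>k x. (deriv ^^ k) f field_differentiable at x)"

definition smooth_vec :: "nat \<Rightarrow> (real \<Rightarrow> real vec) \<Rightarrow> bool" where
  "smooth_vec n X \<longleftrightarrow>
     (\<forall>x. X x \<in> carrier_vec n) \<and> (\<forall>i<n. smooth_fun (\<lambda>x. X x $ i))"

definition smooth_mat :: "nat \<Rightarrow> (real \<Rightarrow> real mat) \<Rightarrow> bool" where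
  "smooth_mat n A \<longleftrightarrow>
     (\<forall>x. A x \<in> carrier_mat n n) \<and> (\<forall>i<n. \<forall>k<n. smooth_fun (\<lambda>x. A x $$ (i, k)))"

definition vec_deriv :: "nat \<Rightarrow> nat \<Rightarrow> (real \<Rightarrow> real vec) \<Rightarrow> real \<Rightarrow> real vec" where
  "vec_deriv n k X x = vec n (\<lambda>i. (deriv ^^ k) (\<lambda>y. X y $ i) x)"

definition mat_deriv :: "nat \<Rightarrow> (real \<Rightarrow> real mat) \<Rightarrow> real \<Rightarrow> real mat" where
  "mat_deriv n A x = mat n n (\<lambda>(i, k). deriv (\<lambda>y. A y $$ (i, k)) x)"

definition commutator :: "'a::ring mat \<Rightarrow> 'a mat \<Rightarrow> 'a mat" where
  "commutator A B = A * B - B * A"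


subsection \<open>Central affine curves\<close>

definition frame_cols :: "nat \<Rightarrow> (real \<Rightarrow> real vec) \<Rightarrow> real \<Rightarrow> real vec list" where
  "frame_cols n \<gamma> x = map (\<lambda>k. vec_deriv n k \<gamma> x) [0..<n]"

definition frame :: "nat \<Rightarrow> (real \<Rightarrow> real vec) \<Rightarrow> real \<Rightarrow> real mat" where
  "frame n \<gamma> x = mat_of_cols n (frame_cols n \<gamma> x)"

definition central_affine_curves :: "nat \<Rightarrow> (real \<Rightarrow> real vec) set" where
  "central_affine_curves n =
     {\<gamma>. smooth_vec n \<gamma> \<and> (\<forall>x. \<gamma> x \<noteq> 0\<^sub>v n) \<and> (\<forall>x. det (frame n \<gamma> x) = 1)}"

definition V_space :: "nat \<Rightarrow> real mat set" where
  "V_space n = {A \<in> carrier_mat n n.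
     \<forall>i<n. \<forall>k<n. A $$ (i, k) \<noteq> 0 \<longrightarrow> i < n - 1 \<and> k = n - 1}"

text \<open>The matrix \<open>u = \<Sum>\<^sub>i u\<^sub>i e\<^sub>i\<^sub>n\<close> whose entries are the coefficients of the \<open>n\<close>-th derivative
  of the curve with respect to its first \<open>n - 1\<close> frame vectors. They exist and are unique for a
  curve in \<open>central_affine_curves n\<close>.\<close>

definition central_affine_curvature ::
  "nat \<Rightarrow> (real \<Rightarrow> real vec) \<Rightarrow> real \<Rightarrow> real mat" where
  "central_affine_curvature n \<gamma> x = (THE u. u \<in> V_space n \<and>
     (\<forall>r<n. vec_deriv n n \<gamma> x $ r =
        (\<Sum>i<n - 1. u $$ (i, n - 1) * vec_deriv n i \<gamma> x $ r)))"

definition tangent_at :: "nat \<Rightarrow> (real \<Rightarrow> real vec) \<Rightarrow> (real \<Rightarrow> real vec) \<Rightarrow> bool" where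
  "tangent_at n \<gamma> X \<longleftrightarrow> smooth_vec n X \<and>
     (\<forall>x. (\<Sum>i<n. det (mat_of_cols n ((frame_cols n \<gamma> x)[i := vec_deriv n i X x]))) = 0)"

text \<open>The evolution equation \<open>\<gamma>\<^sub>t = \<xi>(\<gamma>)\<close> is a flow equation on the space of central affine
  curves if \<open>\<xi>\<close> is a vector field on that space, i.e. assigns to every curve of the space
  a tangent vector at this curve.\<close>

definition flow_equation ::
  "nat \<Rightarrow> ((real \<Rightarrow> real vec) \<Rightarrow> (real \<Rightarrow> real vec)) \<Rightarrow> bool" where
  "flow_equation n \<xi> \<longleftrightarrow> (\<forall>\<gamma> \<in> central_affine_curves n. tangent_at n \<gamma> (\<xi> \<gamma>))"


subsection \<open>The formal series \<open>Y(u,\<lambda>)\<close>\<close>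

text \<open>Series in \<open>\<lambda>\<close> with finitely many positive powers are formal Laurent series in the
  variable \<open>\<lambda>\<^sup>-\<^sup>1\<close>. Hence \<open>\<lambda>\<close> is the inverse of that variable, and the coefficient of \<open>\<lambda>\<^sup>i\<close>
  is the one at position \<open>-i\<close>.\<close>

definition lam :: "real fls" where
  "lam = fls_X_inv"

definition lam_coeff :: "int \<Rightarrow> real fls mat \<Rightarrow> real mat" where
  "lam_coeff i A = map_mat (\<lambda>f. fls_nth f (- i)) A"

definition elem_mat :: "nat \<Rightarrow> nat \<Rightarrow> nat \<Rightarrow> 'a::zero_neq_one mat" where
  "elem_mat n i k = mat n n (\<lambda>p. if p = (i, k) then 1 else 0)"

definition b_mat :: "nat \<Rightarrow> 'a::zero_neq_one mat" where
  "b_mat n = mat n n (\<lambda>(i, k). if i = Suc k then 1 else 0)"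

definition J_mat :: "nat \<Rightarrow> real fls mat" where
  "J_mat n = lam \<cdot>\<^sub>m elem_mat n 0 (n - 1) + b_mat n"

text \<open>That the entries of \<open>Y\<close> and \<open>\<zeta>\<close> are differential polynomials in \<open>u\<close> is a consequence
  and not part of the two specifications below: both objects are already unique among those
  with smooth coefficients.\<close>

definition is_Y_series :: "nat \<Rightarrow> (real \<Rightarrow> real mat) \<Rightarrow> (real \<Rightarrow> real fls mat) \<Rightarrow> bool" where
  "is_Y_series n u Y \<longleftrightarrow>
     (\<forall>x. Y x \<in> carrier_mat n n) \<and>
     (\<forall>i x. i > 1 \<longrightarrow> lam_coeff i (Y x) = 0\<^sub>m n n) \<and>
     (\<forall>x. lam_coeff 1 (Y x) = elem_mat n 0 (n - 1)) \<and>
     (\<forall>i. smooth_mat n (\<lambda>x. lam_coeff i (Y x))) \<and>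
     (\<forall>i x. (\<Sum>k<n. lam_coeff i (Y x) $$ (k, k)) = 0) \<and>
     (\<forall>i x. mat_deriv n (\<lambda>y. lam_coeff i (Y y)) x
        + lam_coeff i (commutator (J_mat n + map_mat fls_const (u x)) (Y x)) = 0\<^sub>m n n) \<and>
     (\<forall>x. Y x ^\<^sub>m n = lam \<cdot>\<^sub>m 1\<^sub>m n)"

definition Y_series :: "nat \<Rightarrow> (real \<Rightarrow> real mat) \<Rightarrow> real \<Rightarrow> real fls mat" where
  "Y_series n u = (THE Y. is_Y_series n u Y)"

definition Y_coeff :: "nat \<Rightarrow> nat \<Rightarrow> int \<Rightarrow> (real \<Rightarrow> real mat) \<Rightarrow> real \<Rightarrow> real mat" where
  "Y_coeff n j i u x = lam_coeff i (Y_series n u x ^\<^sub>m j)"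

definition strictly_upper :: "nat \<Rightarrow> real mat \<Rightarrow> bool" where
  "strictly_upper n A \<longleftrightarrow> A \<in> carrier_mat n n \<and> (\<forall>i<n. \<forall>k\<le>i. A $$ (i, k) = 0)"

definition is_zeta ::
  "nat \<Rightarrow> nat \<Rightarrow> (real \<Rightarrow> real mat) \<Rightarrow> (real \<Rightarrow> real mat) \<Rightarrow> bool" where
  "is_zeta n j u \<zeta> \<longleftrightarrow>
     smooth_mat n \<zeta> \<and> (\<forall>x. strictly_upper n (\<zeta> x)) \<and>
     (\<forall>x. mat_deriv n (\<lambda>y. Y_coeff n j 0 u y - \<zeta> y) x
        + commutator (b_mat n + u x) (Y_coeff n j 0 u x - \<zeta> x) \<in> V_space n)"

definition zeta :: "nat \<Rightarrow> nat \<Rightarrow> (real \<Rightarrow> real mat) \<Rightarrow> real \<Rightarrow> real mat" where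
  "zeta n j u = (THE \<zeta>. is_zeta n j u \<zeta>)"

definition Z0 :: "nat \<Rightarrow> nat \<Rightarrow> (real \<Rightarrow> real mat) \<Rightarrow> real \<Rightarrow> real mat" where
  "Z0 n j u x = Y_coeff n j 0 u x - zeta n j u x"

definition curve_flow_field ::
  "nat \<Rightarrow> nat \<Rightarrow> (real \<Rightarrow> real vec) \<Rightarrow> (real \<Rightarrow> real vec)" where
  "curve_flow_field n j \<gamma> = (\<lambda>x.
     frame n \<gamma> x *\<^sub>v (Z0 n j (central_affine_curvature n \<gamma>) x *\<^sub>v unit_vec n 0))"

end

theory Submission
  imports "HOL-Analysis.Interval_Integral" Defs
begin

unbundle no fps_syntax
unbundle no Formal_Power_Series.fps_syntax
no_notation Finite_Cartesian_Product.vec_nth (infixl \<open>$\<close> 90)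

text \<open>The smooth functions on the line form a commutative differential ring in which the
  derivation is surjective and \<open>n\<close> is invertible, and \<open>Y\<close> is constructed over any such ring.
  Put \<open>X = \<lambda>\<^sup>-\<^sup>1 = z\<^sup>n\<close> and encode row \<open>i\<close> of a matrix \<open>A\<close> of Laurent series in \<open>X\<close> as \<open>\<Sum>\<^sub>k z\<^sup>k\<^sup>-\<^sup>i A\<^sub>i\<^sub>k(z\<^sup>n)\<close>; right multiplication
  by \<open>J\<close> then multiplies every row by \<open>z\<^sup>-\<^sup>1\<close>. The dressing equation \<open>M\<^sub>x + (J + u)M = MJ\<close>
  expresses all rows of \<open>M\<close> through the last one, which must be an eigenfunction of a scalar
  operator of order \<open>n\<close> and is found coefficient by coefficient, by integration. Then
  \<open>Y = MJM\<^sup>-\<^sup>1\<close> has the required properties. If \<open>Y'\<close> is another such series, the rows of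
  \<open>M\<^sup>-\<^sup>1Y'M\<close> satisfy a cyclic difference equation that forces them to coincide; their common value
  has \<open>n\<close>-th power \<open>z\<^sup>-\<^sup>n\<close> and leading term \<open>z\<^sup>-\<^sup>1\<close>, hence equals \<open>z\<^sup>-\<^sup>1\<close>, so \<open>Y' = Y\<close>. Since
  \<open>Y\<^sup>j\<close> is similar to \<open>J\<^sup>j\<close>, it is traceless unless \<open>n\<close> divides \<open>j\<close>, and so is \<open>Z\<^sub>j\<^sub>,\<^sub>0\<close>.

  Because \<open>[\<partial>\<^sub>x + b + u, Z\<^sub>j\<^sub>,\<^sub>0]\<close> vanishes outside the last column, the columns of \<open>gZ\<^sub>j\<^sub>,\<^sub>0\<close> are
  the successive derivatives of \<open>\<xi> = gZ\<^sub>j\<^sub>,\<^sub>0e\<^sub>1\<close>. By Cramer's rule the sum of determinants in the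
  tangency condition is therefore the trace of \<open>Z\<^sub>j\<^sub>,\<^sub>0\<close>, which is zero.\<close>


section \<open>Differential rings\<close>

class differential_ring = comm_ring_1 +
  fixes derivation :: "'a \<Rightarrow> 'a" (\<open>\<partial>\<close>)
  assumes derivation_add: "\<partial> (x + y) = \<partial> x + \<partial> y"
    and derivation_mult: "\<partial> (x * y) = \<partial> x * y + x * \<partial> y"
begin

lemma derivation_0 [simp]: "\<partial> 0 = 0"
  using derivation_add[of 0 0] by simp

lemma derivation_1 [simp]: "\<partial> 1 = 0"
  using derivation_mult[of 1 1] by simp

lemma derivation_minus: "\<partial> (- x) = - \<partial> x"
  using derivation_add[of x "- x"] by (simp add: eq_neg_iff_add_eq_0 add.commute)

lemma derivation_diff: "\<partial> (x - y) = \<partial> x - \<partial> y"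
  using derivation_add[of x "- y"] by (simp add: derivation_minus)

lemma derivation_sum: "\<partial> (\<Sum>i\<in>I. f i) = (\<Sum>i\<in>I. \<partial> (f i))"
  by (induction I rule: infinite_finite_induct) (auto simp: derivation_add)

lemma derivation_of_nat [simp]: "\<partial> (of_nat m) = 0"
  by (induction m) (auto simp: derivation_add)

lemma derivation_of_int [simp]: "\<partial> (of_int m) = 0"
  by (cases m rule: int_cases2) (auto simp: derivation_minus)

lemma derivation_prod:
  "finite I \<Longrightarrow> \<partial> (\<Prod>i\<in>I. f i) = (\<Sum>i\<in>I. \<partial> (f i) * (\<Prod>l\<in>I - {i}. f l))"
proof (induction I rule: finite_induct)
  case (insert j I)
  have "(\<Sum>i\<in>I. \<partial> (f i) * (\<Prod>l\<in>insert j I - {i}. f l))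
      = (\<Sum>i\<in>I. f j * (\<partial> (f i) * (\<Prod>l\<in>I - {i}. f l)))"
  proof (rule sum.cong)
    fix i assume "i \<in> I"
    then have "insert j I - {i} = insert j (I - {i})" using insert by auto
    then show "\<partial> (f i) * (\<Prod>l\<in>insert j I - {i}. f l)
        = f j * (\<partial> (f i) * (\<Prod>l\<in>I - {i}. f l))"
      using insert by (simp add: mult.left_commute)
  qed simp
  then show ?case
    using insert by (simp add: derivation_mult sum_distrib_left)
qed simp

end


section \<open>Coefficientwise maps of Laurent series\<close>

definition fls_map :: "('a::zero \<Rightarrow> 'b::zero) \<Rightarrow> 'a fls \<Rightarrow> 'b fls" where
  "fls_map h f = Abs_fls (\<lambda>m. h (fls_nth f m))"

lemma fls_map_nth [simp]: "h 0 = 0 \<Longrightarrow> fls_nth (fls_map h f) m = h (fls_nth f m)"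
  unfolding fls_map_def by (rule nth_Abs_fls_lower_bound[of "fls_subdegree f"]) simp

lemma fls_times_nth_bounded:
  fixes f g :: "'a::semiring_0 fls"
  assumes f: "\<And>i. i < a \<Longrightarrow> fls_nth f i = 0" and g: "\<And>i. i < b \<Longrightarrow> fls_nth g i = 0"
  shows "fls_nth (f * g) m = (\<Sum>i=a..m - b. fls_nth f i * fls_nth g (m - i))"
proof -
  define I where "I = {min a (fls_subdegree f)..max (m - b) (m - fls_subdegree g)}"
  have "fls_nth (f * g) m = (\<Sum>i\<in>I. fls_nth f i * fls_nth g (m - i))"
    unfolding fls_times_nth(2) I_def by (rule sum.mono_neutral_left) auto
  also have "\<dots> = (\<Sum>i=a..m - b. fls_nth f i * fls_nth g (m - i))"
    unfolding I_def using f g by (intro sum.mono_neutral_right) auto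
  finally show ?thesis .
qed

lemma fls_map_mult:
  assumes "comm_ring_hom h"
  shows "fls_map h (f * g) = fls_map h f * fls_map h g"
proof (rule fls_eqI)
  fix m
  interpret comm_ring_hom h by (fact assms)
  have "fls_nth (fls_map h f * fls_map h g) m
      = (\<Sum>i=fls_subdegree f..m - fls_subdegree g. h (fls_nth f i) * h (fls_nth g (m - i)))"
    by (subst fls_times_nth_bounded[of "fls_subdegree f" _ "fls_subdegree g"]) auto
  then show "fls_nth (fls_map h (f * g)) m = fls_nth (fls_map h f * fls_map h g) m"
    by (simp add: fls_times_nth(2) hom_sum hom_mult)
qed

lemma fls_map_const: "h 0 = 0 \<Longrightarrow> fls_map h (fls_const c) = fls_const (h c)"
  by (rule fls_eqI) simp

lemma comm_ring_hom_fls_map: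
  assumes "comm_ring_hom h"
  shows "comm_ring_hom (fls_map h)"
proof -
  interpret comm_ring_hom h by (fact assms)
  show ?thesis
    by unfold_locales (auto intro!: fls_eqI simp: hom_add fls_map_mult[OF assms])
qed

lemma fls_map_X_inv: "h 0 = 0 \<Longrightarrow> h 1 = 1 \<Longrightarrow> fls_map h fls_X_inv = fls_X_inv"
  by (rule fls_eqI) simp

instantiation fps :: (differential_ring) differential_ring
begin

definition derivation_fps_def: "\<partial> f = Abs_fps (\<lambda>m. \<partial> (fps_nth f m))"

lemma fps_nth_derivation [simp]: "fps_nth (\<partial> f) m = \<partial> (fps_nth f m)"
  for f :: "'a fps"
  by (simp add: derivation_fps_def)

instance
proof
  fix f g :: "'a fps"
  show "\<partial> (f + g) = \<partial> f + \<partial> g"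
    by (rule fps_ext) (simp add: derivation_add)
  show "\<partial> (f * g) = \<partial> f * g + f * \<partial> g"
    by (rule fps_ext) (simp add: fps_mult_nth derivation_sum derivation_mult sum.distrib)
qed

end

instantiation fls :: (differential_ring) differential_ring
begin

definition derivation_fls_def: "\<partial> f = fls_map \<partial> f"

lemma fls_nth_derivation [simp]: "fls_nth (\<partial> f) m = \<partial> (fls_nth f m)"
  for f :: "'a fls"
  by (simp add: derivation_fls_def)

instance
proof
  fix f g :: "'a fls"
  show "\<partial> (f + g) = \<partial> f + \<partial> g"
    by (rule fls_eqI) (simp add: derivation_add)
  show "\<partial> (f * g) = \<partial> f * g + f * \<partial> g"
  proof (rule fls_eqI)
    fix m
    let ?I = "{fls_subdegree f..m - fls_subdegree g}"
    have "fls_nth (\<partial> f * g) m = (\<Sum>i\<in>?I. \<partial> (fls_nth f i) * fls_nth g (m - i))"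
      "fls_nth (f * \<partial> g) m = (\<Sum>i\<in>?I. fls_nth f i * \<partial> (fls_nth g (m - i)))"
      by (subst fls_times_nth_bounded[of "fls_subdegree f" _ "fls_subdegree g"]; simp)+
    then show "fls_nth (\<partial> (f * g)) m = fls_nth (\<partial> f * g + f * \<partial> g) m"
      by (simp add: fls_times_nth(2) derivation_sum derivation_mult sum.distrib)
  qed
qed

end

lemma derivation_fps_to_fls: "\<partial> (fps_to_fls f) = fps_to_fls (\<partial> f)"
  by (rule fls_eqI) simp

lemma derivation_fps_X [simp]: "\<partial> fps_X = 0"
  by (rule fps_ext) (simp add: fps_X_def)


section \<open>Matrices over differential rings\<close>

lemma index_mult_mat_sum:
  assumes "A \<in> carrier_mat m n" "B \<in> carrier_mat n k" "i < m" "l < k"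
  shows "(A * B) $$ (i, l) = (\<Sum>r<n. A $$ (i, r) * B $$ (r, l))"
  using assms by (auto simp: scalar_prod_def lessThan_atLeast0 intro!: sum.cong)

lemma map_mat_derivation_mult:
  fixes A B :: "'a::differential_ring mat"
  assumes A: "A \<in> carrier_mat m n" and B: "B \<in> carrier_mat n k"
  shows "map_mat \<partial> (A * B) = map_mat \<partial> A * B + A * map_mat \<partial> B"
proof (rule eq_matI)
  have deriv_A: "map_mat \<partial> A \<in> carrier_mat m n" and deriv_B: "map_mat \<partial> B \<in> carrier_mat n k"
    using A B by simp_all
  fix i l assume "i < dim_row (map_mat \<partial> A * B + A * map_mat \<partial> B)"
    "l < dim_col (map_mat \<partial> A * B + A * map_mat \<partial> B)"
  then have il: "i < m" "l < k" using A B by auto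
  have "map_mat \<partial> (A * B) $$ (i, l) =
      (\<Sum>r<n. \<partial> (A $$ (i, r)) * B $$ (r, l) + A $$ (i, r) * \<partial> (B $$ (r, l)))"
    using il A B
    by (simp add: index_mult_mat_sum[OF A B il] derivation_sum derivation_mult
        del: index_mult_mat(1))
  also have "\<dots> = (map_mat \<partial> A * B) $$ (i, l) + (A * map_mat \<partial> B) $$ (i, l)"
    unfolding index_mult_mat_sum[OF deriv_A B il] index_mult_mat_sum[OF A deriv_B il]
    using il A B by (simp add: sum.distrib)
  finally show "map_mat \<partial> (A * B) $$ (i, l) = (map_mat \<partial> A * B + A * map_mat \<partial> B) $$ (i, l)"
    using il A B by simp
qed (use A B in auto)

lemma map_mat_derivation_one [simp]:
  "map_mat \<partial> (1\<^sub>m n) = (0\<^sub>m n n :: 'a::differential_ring mat)"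
  by (rule eq_matI) auto

lemmas square_mat_simps =
  mult_carrier_mat[of _ n n _ n] add_carrier_mat[of _ n n] one_carrier_mat[of n]
  assoc_mult_mat[of _ n n _ n _ n] add_mult_distrib_mat[of _ n n _ _ n]
  mult_add_distrib_mat[of _ n n _ n] assoc_add_mat[of _ n n]
  right_mult_one_mat[of _ n n] left_mult_one_mat[of _ n n] for n

definition mat_trace :: "'a::comm_ring_1 mat \<Rightarrow> 'a" where
  "mat_trace A = (\<Sum>i<dim_row A. A $$ (i, i))"

lemma mat_trace_mult_comm:
  assumes A: "A \<in> carrier_mat m n" and B: "B \<in> carrier_mat n m"
  shows "mat_trace (A * B) = mat_trace (B * A)"
proof -
  have "mat_trace (A * B) = (\<Sum>i<m. \<Sum>l<n. A $$ (i, l) * B $$ (l, i))"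
    using A by (simp add: mat_trace_def index_mult_mat_sum[OF A B] del: index_mult_mat(1))
  also have "\<dots> = (\<Sum>l<n. \<Sum>i<m. B $$ (l, i) * A $$ (i, l))"
    by (subst sum.swap) (simp add: mult.commute)
  also have "\<dots> = mat_trace (B * A)"
    using B by (simp add: mat_trace_def index_mult_mat_sum[OF B A] del: index_mult_mat(1))
  finally show ?thesis .
qed

lemma mat_trace_similar:
  assumes "similar_mat_wit A B P Q"
  shows "mat_trace A = mat_trace B"
proof -
  define n where "n = dim_row A"
  note wit = similar_mat_witD[OF n_def assms]
  have "mat_trace A = mat_trace (P * (B * Q))"
    unfolding wit(3) by (simp only: square_mat_simps[where n=n] wit(5-7))
  also have "\<dots> = mat_trace (B * Q * P)"
    using wit by (intro mat_trace_mult_comm[of _ n n]) auto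
  also have "B * Q * P = B"
    by (simp only: square_mat_simps[where n=n] wit(2,5-7))
  finally show ?thesis .
qed

definition covariant_deriv :: "'a::differential_ring mat \<Rightarrow> 'a mat \<Rightarrow> 'a mat" where
  "covariant_deriv A Z = map_mat \<partial> Z + commutator A Z"

lemma covariant_deriv_carrier [simp]:
  "A \<in> carrier_mat n n \<Longrightarrow> Z \<in> carrier_mat n n \<Longrightarrow> covariant_deriv A Z \<in> carrier_mat n n"
  by (simp add: covariant_deriv_def commutator_def minus_carrier_mat)

lemma covariant_deriv_index:
  assumes "A \<in> carrier_mat n n" "Z \<in> carrier_mat n n" "i < n" "k < n"
  shows "covariant_deriv A Z $$ (i, k) = \<partial> (Z $$ (i, k)) + (A * Z) $$ (i, k) - (Z * A) $$ (i, k)"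
  using assms by (simp add: covariant_deriv_def commutator_def del: index_mult_mat(1))

lemma mat_trace_covariant_deriv:
  assumes A: "A \<in> carrier_mat n n" and Z: "Z \<in> carrier_mat n n"
  shows "mat_trace (covariant_deriv A Z) = \<partial> (mat_trace Z)"
proof -
  have dims: "dim_row (covariant_deriv A Z) = n" "dim_row Z = n" "dim_row A = n"
    using carrier_matD(1)[OF covariant_deriv_carrier[OF A Z]] A Z by auto
  have "mat_trace (covariant_deriv A Z) = \<partial> (mat_trace Z) + mat_trace (A * Z) - mat_trace (Z * A)"
    by (simp add: mat_trace_def dims covariant_deriv_index[OF A Z] derivation_sum sum.distrib
        sum_subtractf del: index_mult_mat(1))
  then show ?thesis using mat_trace_mult_comm[OF A Z] by simp
qed

definition intertwines :: "'a::differential_ring mat \<Rightarrow> 'a mat \<Rightarrow> 'a mat \<Rightarrow> bool" where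
  "intertwines A B M \<longleftrightarrow> map_mat \<partial> M + A * M = M * B"

lemma covariant_deriv_eq_0_iff:
  assumes A: "A \<in> carrier_mat n n" and Z: "Z \<in> carrier_mat n n"
  shows "covariant_deriv A Z = 0\<^sub>m n n \<longleftrightarrow> intertwines A A Z"
proof -
  have "covariant_deriv A Z = 0\<^sub>m n n
      \<longleftrightarrow> (\<forall>i<n. \<forall>k<n. \<partial> (Z $$ (i, k)) + (A * Z) $$ (i, k) - (Z * A) $$ (i, k) = 0)"
    using covariant_deriv_carrier[OF A Z]
    by (auto simp: mat_eq_iff covariant_deriv_index[OF A Z] simp del: index_mult_mat(1))
  also have "\<dots> \<longleftrightarrow> intertwines A A Z"
    using A Z by (auto simp: intertwines_def mat_eq_iff simp del: index_mult_mat(1))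
  finally show ?thesis .
qed

lemma intertwines_mult:
  assumes carrier: "A \<in> carrier_mat n n" "B \<in> carrier_mat n n" "C \<in> carrier_mat n n"
      "M \<in> carrier_mat n n" "N \<in> carrier_mat n n"
    and M: "intertwines A B M" and N: "intertwines B C N"
  shows "intertwines A C (M * N)"
proof -
  note mat_simps = square_mat_simps[where n=n]
  have deriv_carrier: "map_mat \<partial> M \<in> carrier_mat n n" "map_mat \<partial> N \<in> carrier_mat n n"
    using carrier by simp_all
  have "map_mat \<partial> (M * N) + A * (M * N)
      = (map_mat \<partial> M * N + M * map_mat \<partial> N) + A * (M * N)"
    by (simp only: map_mat_derivation_mult[OF carrier(4,5)])
  also have "\<dots> = (map_mat \<partial> M + A * M) * N + M * map_mat \<partial> N"
    using comm_add_mat[of "M * map_mat \<partial> N" n n "A * (M * N)"]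
    by (simp only: mat_simps carrier deriv_carrier)
  also have "\<dots> = M * (B * N) + M * map_mat \<partial> N"
    using M unfolding intertwines_def by (simp only: mat_simps carrier)
  also have "\<dots> = M * (map_mat \<partial> N + B * N)"
    using comm_add_mat[of "M * map_mat \<partial> N" n n "M * (B * N)"]
    by (simp only: mat_simps carrier deriv_carrier)
  also have "\<dots> = (M * N) * C"
    using N unfolding intertwines_def by (simp only: mat_simps carrier)
  finally show ?thesis unfolding intertwines_def .
qed

lemma intertwines_one: "A \<in> carrier_mat n n \<Longrightarrow> intertwines A A (1\<^sub>m n)"
  by (simp add: intertwines_def)

lemma intertwines_pow:
  assumes "A \<in> carrier_mat n n" "M \<in> carrier_mat n n" "intertwines A A M"
  shows "intertwines A A (M ^\<^sub>m k)"
proof (induction k)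
  case 0
  then show ?case using assms intertwines_one by simp
next
  case (Suc k)
  then show ?case using assms intertwines_mult[of A n A A "M ^\<^sub>m k" M] by simp
qed

lemma intertwines_inverse:
  assumes carrier: "A \<in> carrier_mat n n" "B \<in> carrier_mat n n"
      "M \<in> carrier_mat n n" "N \<in> carrier_mat n n"
    and MN: "M * N = 1\<^sub>m n" and NM: "N * M = 1\<^sub>m n" and M: "intertwines A B M"
  shows "intertwines B A N"
proof -
  note mat_simps = square_mat_simps[where n=n]
  have deriv_carrier: "map_mat \<partial> M \<in> carrier_mat n n" "map_mat \<partial> N \<in> carrier_mat n n"
    using carrier by simp_all
  have deriv_NM: "map_mat \<partial> N * M + N * map_mat \<partial> M = 0\<^sub>m n n"
    using map_mat_derivation_mult[OF carrier(4,3)] by (simp add: NM)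
  have "B = N * (M * B)"
    using carrier by (simp add: NM flip: assoc_mult_mat[OF carrier(4,3,2)])
  also have "\<dots> = N * (map_mat \<partial> M + A * M)"
    using M by (simp add: intertwines_def)
  also have "\<dots> = N * map_mat \<partial> M + N * (A * M)"
    by (simp only: mat_simps carrier deriv_carrier)
  finally have B: "B = N * map_mat \<partial> M + N * (A * M)" .
  have "(map_mat \<partial> N + B * N) * M = map_mat \<partial> N * M + B"
    by (simp only: mat_simps carrier deriv_carrier NM)
  also have "\<dots> = (map_mat \<partial> N * M + N * map_mat \<partial> M) + N * (A * M)"
    by (subst B) (simp only: mat_simps carrier deriv_carrier)
  also have "\<dots> = (N * A) * M"
    unfolding deriv_NM using carrier by simp
  finally have "(map_mat \<partial> N + B * N) * M * N = (N * A) * M * N" by simp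
  then show ?thesis
    unfolding intertwines_def by (simp only: mat_simps carrier deriv_carrier MN)
qed

lemma derivation_det:
  fixes A :: "'a::differential_ring mat"
  assumes A: "A \<in> carrier_mat n n"
  shows "\<partial> (det A) = (\<Sum>k<n. det (replace_col A (col (map_mat \<partial> A) k) k))"
proof -
  let ?R = "\<lambda>k. replace_col A (col (map_mat \<partial> A) k) k"
  have R: "?R k \<in> carrier_mat n n" for k using A by (auto simp: replace_col_def)
  have prod: "(\<Prod>l<n. ?R k $$ (p l, l)) = \<partial> (A $$ (p k, k)) * (\<Prod>l\<in>{..<n} - {k}. A $$ (p l, l))"
    if p: "p permutes {0..<n}" and k: "k < n" for p k
  proof -
    have p_less: "p l < n" if "l < n" for l using permutes_in_image[OF p, of l] that by simp
    have "(\<Prod>l<n. ?R k $$ (p l, l)) = ?R k $$ (p k, k) * (\<Prod>l\<in>{..<n} - {k}. ?R k $$ (p l, l))"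
      using k by (intro prod.remove) auto
    moreover have "(\<Prod>l\<in>{..<n} - {k}. ?R k $$ (p l, l)) = (\<Prod>l\<in>{..<n} - {k}. A $$ (p l, l))"
      using p_less A by (intro prod.cong) (auto simp: replace_col_def)
    ultimately show ?thesis using p_less[OF k] k A by (simp add: replace_col_def)
  qed
  have "\<partial> (det A) = (\<Sum>p | p permutes {0..<n}. signof p *
      (\<Sum>k<n. \<partial> (A $$ (p k, k)) * (\<Prod>l\<in>{..<n} - {k}. A $$ (p l, l))))"
    unfolding det_col[OF A] derivation_sum
    by (intro sum.cong) (auto simp: derivation_mult derivation_prod sign_def)
  also have "\<dots> = (\<Sum>p | p permutes {0..<n}. \<Sum>k<n. signof p * (\<Prod>l<n. ?R k $$ (p l, l)))"
    unfolding sum_distrib_left by (intro sum.cong refl) (simp add: prod)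
  also have "\<dots> = (\<Sum>k<n. det (?R k))"
    unfolding det_col[OF R] by (rule sum.swap)
  finally show ?thesis .
qed

lemma sum_det_replace_col_mult:
  fixes A :: "'a::comm_ring_1 mat"
  assumes A: "A \<in> carrier_mat n n" and B: "B \<in> carrier_mat n n"
  shows "(\<Sum>k<n. det (replace_col A (col (A * B) k) k)) = mat_trace B * det A"
proof -
  have "det (replace_col A (col (A * B) k) k) = B $$ (k, k) * det A" if k: "k < n" for k
  proof -
    have "col (A * B) k = A *\<^sub>v col B k" using A B k by (intro col_mult2)
    moreover have "col B k \<in> carrier_vec n" using B by (simp add: carrier_vecI)
    ultimately show ?thesis using cramer_lemma_mat[OF A _ k, of "col B k"] B k by simp
  qed
  then show ?thesis using B by (simp add: mat_trace_def sum_distrib_right)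
qed

lemma derivation_det_mult:
  fixes G :: "'a::differential_ring mat"
  assumes "G \<in> carrier_mat n n" "B \<in> carrier_mat n n" "map_mat \<partial> G = G * B"
  shows "\<partial> (det G) = mat_trace B * det G"
  using derivation_det[OF assms(1)] sum_det_replace_col_mult[OF assms(1,2)] assms(3) by simp


section \<open>Matrices supported in the last column\<close>

text \<open>The space \<open>V\<^sub>n\<close> over an arbitrary ring. Over Laurent series it contains \<open>e\<^sub>1\<^sub>n\<lambda> + u\<close>, so that
  the index rules for \<open>b + v\<close> also apply to \<open>J + u\<close>.\<close>

definition V_mats :: "nat \<Rightarrow> 'a::zero mat set" where
  "V_mats n = {A \<in> carrier_mat n n.
     \<forall>i<n. \<forall>k<n. A $$ (i, k) \<noteq> 0 \<longrightarrow> i < n - 1 \<and> k = n - 1}"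

lemma
  assumes "v \<in> V_mats n"
  shows V_mats_carrier: "v \<in> carrier_mat n n"
    and V_mats_index_left: "i < n \<Longrightarrow> Suc k < n \<Longrightarrow> v $$ (i, k) = 0"
    and V_mats_corner: "n > 0 \<Longrightarrow> v $$ (n - 1, n - 1) = 0"
proof -
  have carrier: "v \<in> carrier_mat n n"
    and support: "\<And>i k. i < n \<Longrightarrow> k < n \<Longrightarrow> v $$ (i, k) \<noteq> 0 \<Longrightarrow> i < n - 1 \<and> k = n - 1"
    using assms unfolding V_mats_def by auto
  show "v \<in> carrier_mat n n" by (fact carrier)
  show "v $$ (i, k) = 0" if "i < n" "Suc k < n" using support[of i k] that by fastforce
  show "v $$ (n - 1, n - 1) = 0" if "n > 0" using support[of "n - 1" "n - 1"] that by fastforce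
qed

lemma V_matsI:
  assumes "v \<in> carrier_mat n n" "\<And>i k. i < n \<Longrightarrow> Suc k < n \<Longrightarrow> v $$ (i, k) = 0"
    and "v $$ (n - 1, n - 1) = 0"
  shows "v \<in> V_mats n"
proof -
  have "i < n - 1 \<and> k = n - 1" if "i < n" "k < n" "v $$ (i, k) \<noteq> 0" for i k
  proof -
    have k: "k = n - 1" using assms(2)[OF that(1), of k] that by (cases "Suc k < n") auto
    moreover have "i \<noteq> n - 1" using assms(3) that(3) k by auto
    ultimately show ?thesis using that(1) by simp
  qed
  then show ?thesis using assms(1) unfolding V_mats_def by blast
qed

lemma b_mat_carrier [simp]: "b_mat n \<in> carrier_mat n n"
  by (simp add: b_mat_def)

lemma dim_b_mat [simp]: "dim_row (b_mat n) = n" "dim_col (b_mat n) = n"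
  by (simp_all add: b_mat_def)

lemma b_mat_index: "i < n \<Longrightarrow> k < n \<Longrightarrow> b_mat n $$ (i, k) = (if i = Suc k then 1 else 0)"
  by (simp add: b_mat_def)

lemma b_mat_add_V_mats_index:
  assumes "v \<in> V_mats n" "i < n" "k < n"
  shows "(b_mat n + v) $$ (i, k)
    = (if i = Suc k then 1 else 0) + (if k = n - 1 then v $$ (i, n - 1) else 0 :: 'a::comm_ring_1)"
  using assms V_mats_carrier[OF assms(1)] V_mats_index_left[OF assms(1)] by (auto simp: b_mat_index)

lemma b_mat_add_V_mats_mult_index:
  fixes v A :: "'a::comm_ring_1 mat"
  assumes v: "v \<in> V_mats n" and A: "A \<in> carrier_mat n n" and ik: "i < n" "k < n"
  shows "((b_mat n + v) * A) $$ (i, k)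
    = (if i = 0 then 0 else A $$ (i - 1, k)) + v $$ (i, n - 1) * A $$ (n - 1, k)"
proof -
  have "((b_mat n + v) * A) $$ (i, k)
      = (\<Sum>l<n. (if i = Suc l then A $$ (l, k) else 0)
        + (if l = n - 1 then v $$ (i, n - 1) * A $$ (n - 1, k) else 0))"
    unfolding index_mult_mat_sum[OF add_carrier_mat[OF V_mats_carrier[OF v], of "b_mat n"] A ik]
    by (intro sum.cong) (auto simp: b_mat_add_V_mats_index[OF v ik(1)] distrib_right)
  also have "\<dots> = (\<Sum>l<n. if i = Suc l then A $$ (l, k) else 0) + v $$ (i, n - 1) * A $$ (n - 1, k)"
    using ik by (simp add: sum.distrib)
  also have "(\<Sum>l<n. if i = Suc l then A $$ (l, k) else 0) = (if i = 0 then 0 else A $$ (i - 1, k))"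
    using ik by (cases i) auto
  finally show ?thesis .
qed

lemma mult_b_mat_add_V_mats_index:
  fixes v A :: "'a::comm_ring_1 mat"
  assumes v: "v \<in> V_mats n" and A: "A \<in> carrier_mat m n" and ik: "i < m" "Suc k < n"
  shows "(A * (b_mat n + v)) $$ (i, k) = A $$ (i, Suc k)"
proof -
  have "(A * (b_mat n + v)) $$ (i, k) = (\<Sum>l<n. if l = Suc k then A $$ (i, l) else 0)"
    unfolding index_mult_mat_sum[OF A add_carrier_mat[OF V_mats_carrier[OF v], of "b_mat n"]
        ik(1) Suc_lessD[OF ik(2)]]
    using ik by (intro sum.cong) (auto simp: b_mat_add_V_mats_index[OF v])
  then show ?thesis using ik by simp
qed

lemma mult_V_mats_last_index:
  fixes v G :: "'a::comm_ring_1 mat"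
  assumes v: "v \<in> V_mats n" and G: "G \<in> carrier_mat m n" and r: "r < m" and n: "n > 0"
  shows "(G * v) $$ (r, n - 1) = (\<Sum>i<n - 1. G $$ (r, i) * v $$ (i, n - 1))"
proof -
  obtain l where l: "n = Suc l" using n by (cases n) auto
  have "(G * v) $$ (r, n - 1) = (\<Sum>i<n. G $$ (r, i) * v $$ (i, n - 1))"
    using n by (intro index_mult_mat_sum[OF G V_mats_carrier[OF v] r]) simp
  then show ?thesis using V_mats_corner[OF v n] by (simp add: l)
qed

lemma V_mats_eqI:
  fixes G :: "'a::comm_ring_1 mat"
  assumes G: "G \<in> carrier_mat n n" "det G = 1" and v: "v \<in> V_mats n" and w: "w \<in> V_mats n"
    and last: "\<And>r. r < n \<Longrightarrow> (G * v) $$ (r, n - 1) = (G * w) $$ (r, n - 1)"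
  shows "v = w"
proof -
  note carrier = V_mats_carrier[OF v] V_mats_carrier[OF w]
  have "(G * v) $$ (r, k) = (G * w) $$ (r, k)" if rk: "r < n" "k < n" for r k
  proof (cases "Suc k < n")
    case True
    then show ?thesis
      unfolding index_mult_mat_sum[OF G(1) carrier(1) rk] index_mult_mat_sum[OF G(1) carrier(2) rk]
      by (simp add: V_mats_index_left[OF v] V_mats_index_left[OF w])
  next
    case False
    then have "k = n - 1" using rk by simp
    then show ?thesis using last rk by simp
  qed
  then have eq: "G * v = G * w"
    using G(1) carrier by (intro eq_matI) (auto simp del: index_mult_mat(1))
  have adj: "adj_mat G \<in> carrier_mat n n" "adj_mat G * G = 1\<^sub>m n"
    using adj_mat[OF G(1)] G(2) by auto
  have "adj_mat G * (G * v) = v" "adj_mat G * (G * w) = w"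
    using carrier by (simp_all add: adj(2) flip: assoc_mult_mat[OF adj(1) G(1)])
  then show ?thesis using eq by metis
qed

lemma covariant_deriv_V_mats_index:
  assumes v: "v \<in> V_mats n" and Z: "Z \<in> carrier_mat n n" and i: "i < n" and k: "Suc k < n"
  shows "covariant_deriv (b_mat n + v) Z $$ (i, k)
    = \<partial> (Z $$ (i, k)) + ((if i = 0 then 0 else Z $$ (i - 1, k)) + v $$ (i, n - 1) * Z $$ (n - 1, k))
      - Z $$ (i, Suc k)"
  using covariant_deriv_index[of "b_mat n + v" n Z i k] V_mats_carrier[OF v] assms
  by (simp add: b_mat_add_V_mats_mult_index[OF v Z i] mult_b_mat_add_V_mats_index[OF v Z i k]
      del: index_mult_mat(1))


section \<open>Rows as Laurent series in an n-th root of the variable\<close>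

definition fls_subst_power :: "nat \<Rightarrow> 'a::zero fls \<Rightarrow> 'a fls" where
  "fls_subst_power n f = Abs_fls (\<lambda>m. if int n dvd m then fls_nth f (m div int n) else 0)"

lemma fls_subst_power_nth:
  assumes "n > 0"
  shows "fls_nth (fls_subst_power n f) m = (if int n dvd m then fls_nth f (m div int n) else 0)"
  unfolding fls_subst_power_def
  by (rule nth_Abs_fls_lower_bound[of "int n * fls_subdegree f"]) (use assms in auto)

lemma fls_subst_power_0 [simp]: "n > 0 \<Longrightarrow> fls_subst_power n 0 = 0"
  by (rule fls_eqI) (simp add: fls_subst_power_nth)

lemma fls_subst_power_const:
  assumes "n > 0"
  shows "fls_subst_power n (fls_const c) = fls_const c"
  using assms by (intro fls_eqI) (auto simp: fls_subst_power_nth)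

lemma fls_subst_power_1 [simp]: "n > 0 \<Longrightarrow> fls_subst_power n 1 = 1"
  using fls_subst_power_const[of n 1] by simp

lemma fls_subst_power_add:
  "n > 0 \<Longrightarrow> fls_subst_power n (f + g) = fls_subst_power n f + fls_subst_power n g"
  by (rule fls_eqI) (simp add: fls_subst_power_nth)

lemma fls_subst_power_sum:
  "n > 0 \<Longrightarrow> fls_subst_power n (\<Sum>i\<in>I. f i) = (\<Sum>i\<in>I. fls_subst_power n (f i))"
  by (induction I rule: infinite_finite_induct) (auto simp: fls_subst_power_add)

lemma multiples_in_interval:
  fixes a b c :: int
  assumes "c > 0"
  shows "{c * a..c * b} \<inter> {i. c dvd i} = (*) c ` {a..b}"
  using assms by (auto elim!: dvdE)

lemma fls_subst_power_mult:
  fixes f g :: "'a::semiring_0 fls"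
  assumes n: "n > 0"
  shows "fls_subst_power n (f * g) = fls_subst_power n f * fls_subst_power n g"
proof (rule fls_eqI)
  fix m
  let ?\<sigma> = "fls_subst_power n"
  let ?I = "{int n * fls_subdegree f..m - int n * fls_subdegree g}"
  have "fls_nth (?\<sigma> h) i = 0" if "i < int n * fls_subdegree h" for h :: "'a fls" and i
    using that n by (auto simp: fls_subst_power_nth)
  then have product:
    "fls_nth (?\<sigma> f * ?\<sigma> g) m = (\<Sum>i\<in>?I. fls_nth (?\<sigma> f) i * fls_nth (?\<sigma> g) (m - i))"
    by (intro fls_times_nth_bounded)
  show "fls_nth (?\<sigma> (f * g)) m = fls_nth (?\<sigma> f * ?\<sigma> g) m"
  proof (cases "int n dvd m")
    case False
    then have "fls_nth (?\<sigma> f) i * fls_nth (?\<sigma> g) (m - i) = 0" for i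
      using n dvd_add[of "int n" i "m - i"] by (auto simp: fls_subst_power_nth)
    then show ?thesis using False n by (simp add: product fls_subst_power_nth)
  next
    case True
    then obtain q where m: "m = int n * q" by (auto elim: dvdE)
    let ?P = "{fls_subdegree f..q - fls_subdegree g}"
    have multiples: "?I \<inter> {i. int n dvd i} = (*) (int n) ` ?P"
      using multiples_in_interval[of "int n"] n by (simp add: m flip: right_diff_distrib)
    have "fls_nth (?\<sigma> f * ?\<sigma> g) m
        = (\<Sum>i\<in>(*) (int n) ` ?P. fls_nth (?\<sigma> f) i * fls_nth (?\<sigma> g) (m - i))"
      unfolding product multiples[symmetric]
      using n by (intro sum.mono_neutral_right) (auto simp: fls_subst_power_nth)
    also have "\<dots> = (\<Sum>p\<in>?P. fls_nth f p * fls_nth g (q - p))"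
      using n by (subst sum.reindex)
        (auto simp: inj_on_def m fls_subst_power_nth simp flip: right_diff_distrib)
    also have "\<dots> = fls_nth (?\<sigma> (f * g)) m"
      using n by (simp add: m fls_subst_power_nth fls_times_nth(2))
    finally show ?thesis ..
  qed
qed

lemma fls_subst_power_X_inv:
  assumes n: "n > 0"
  shows "fls_subst_power n (fls_X_inv :: 'a::zero_neq_one fls) = fls_shift (int n) 1"
proof (rule fls_eqI)
  fix m
  have "int n dvd m \<and> m div int n = - 1 \<longleftrightarrow> m = int n * (- 1)"
    using n
    by (metis dvd_mult_div_cancel dvd_triv_left nonzero_mult_div_cancel_left of_nat_eq_0_iff
        neq0_conv)
  then show "fls_nth (fls_subst_power n (fls_X_inv :: 'a fls)) m = fls_nth (fls_shift (int n) 1) m"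
    using n by (auto simp: fls_subst_power_nth)
qed

definition row_series :: "nat \<Rightarrow> 'a::comm_ring_1 fls mat \<Rightarrow> nat \<Rightarrow> 'a fls" where
  "row_series n A i = (\<Sum>k<n. fls_shift (int i - int k) (fls_subst_power n (A $$ (i, k))))"

lemma row_series_nth:
  assumes n: "n > 0"
  shows "fls_nth (row_series n A i) m
    = fls_nth (A $$ (i, nat ((m + int i) mod int n))) ((m + int i) div int n)"
proof -
  define r where "r = nat ((m + int i) mod int n)"
  have r: "r < n" "int r = (m + int i) mod int n" using n by (auto simp: r_def nat_less_iff)
  have "fls_nth (fls_shift (int i - int k) (fls_subst_power n (A $$ (i, k)))) m
      = (if k = r then fls_nth (A $$ (i, k)) ((m + int i) div int n) else 0)" if k: "k < n" for k
  proof -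
    have "int n dvd m + int i - int k \<longleftrightarrow> k = r"
      using k by (simp add: r(2) flip: mod_eq_dvd_iff of_nat_eq_iff[where 'a = int]) auto
    moreover have "(m + int i - int r) div int n = (m + int i) div int n"
      using n by (simp add: r(2) minus_mod_eq_mult_div)
    ultimately show ?thesis using n by (auto simp: fls_subst_power_nth algebra_simps)
  qed
  then have "fls_nth (row_series n A i) m
      = (\<Sum>k<n. if k = r then fls_nth (A $$ (i, k)) ((m + int i) div int n) else 0)"
    by (simp add: row_series_def fls_nth_sum)
  then show ?thesis using r(1) by (simp add: r_def)
qed

lemma fls_nth_mat_index:
  assumes "k < n"
  shows "fls_nth (A $$ (i, k)) q = fls_nth (row_series n A i) (int n * q + int k - int i)"
  using assms by (simp add: row_series_nth)

lemma row_series_eqI: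
  assumes "A \<in> carrier_mat n n" "B \<in> carrier_mat n n"
    and "\<And>i. i < n \<Longrightarrow> row_series n A i = row_series n B i"
  shows "A = B"
proof (rule eq_matI)
  fix i k assume "i < dim_row B" "k < dim_col B"
  then have "i < n" "k < n" using assms by auto
  then show "A $$ (i, k) = B $$ (i, k)"
    using assms(3) by (intro fls_eqI) (simp add: fls_nth_mat_index[of k n])
qed (use assms in auto)

lemma row_series_surj:
  fixes h :: "nat \<Rightarrow> 'a::comm_ring_1 fls"
  assumes n: "n > 0"
  obtains A where "A \<in> carrier_mat n n" "\<And>i. i < n \<Longrightarrow> row_series n A i = h i"
proof -
  define A where "A = mat n n (\<lambda>(i, k). Abs_fls (\<lambda>q. fls_nth (h i) (int n * q + int k - int i)))"
  have "fls_nth (A $$ (i, k)) q = fls_nth (h i) (int n * q + int k - int i)"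
    if ik: "i < n" "k < n" for i k q
  proof -
    have "fls_nth (h i) (int n * q + int k - int i) = 0"
      if q: "q < min 0 (fls_subdegree (h i) - int n)" for q
    proof -
      have "int n * q \<le> 1 * q" using n q by (intro mult_right_mono_neg) auto
      moreover have "q < fls_subdegree (h i) - int n" using q by simp
      ultimately have "int n * q + int k - int i < fls_subdegree (h i)" using ik by linarith
      then show ?thesis by simp
    qed
    then show ?thesis unfolding A_def using ik
      by (simp add: nth_Abs_fls_lower_bound[of "min 0 (fls_subdegree (h i) - int n)"])
  qed
  then have "row_series n A i = h i" if "i < n" for i
    using that n by (intro fls_eqI) (simp add: row_series_nth nat_less_iff)
  moreover have "A \<in> carrier_mat n n" by (simp add: A_def)
  ultimately show ?thesis using that by blast
qed

lemma row_series_add: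
  assumes "n > 0" "A \<in> carrier_mat n n" "B \<in> carrier_mat n n" "i < n"
  shows "row_series n (A + B) i = row_series n A i + row_series n B i"
  using assms by (intro fls_eqI) (simp add: row_series_nth nat_less_iff)

lemma row_series_derivation:
  assumes "n > 0" "A \<in> carrier_mat n n" "i < n"
  shows "row_series n (map_mat \<partial> A) i = \<partial> (row_series n A i)"
  using assms by (intro fls_eqI) (simp add: row_series_nth nat_less_iff)

lemma row_series_one:
  assumes "i < n"
  shows "row_series n (1\<^sub>m n) i = 1"
proof (rule fls_eqI)
  fix m
  have n: "n > 0" using assms by simp
  define r where "r = nat ((m + int i) mod int n)"
  have r: "r < n" "m + int i = int n * ((m + int i) div int n) + int r"
    using n by (auto simp: r_def nat_less_iff)
  have "m = 0" if "i = r" "(m + int i) div int n = 0"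
    using r(2) that(1) unfolding that(2) by simp
  moreover have "i = r \<and> (m + int i) div int n = 0" if "m = 0"
    using assms that by (simp add: r_def)
  ultimately have "m = 0 \<longleftrightarrow> i = r \<and> (m + int i) div int n = 0" by blast
  then show "fls_nth (row_series n (1\<^sub>m n) i) m = fls_nth 1 m"
    using r(1) assms n by (simp add: row_series_nth flip: r_def)
qed

lemma row_series_mult:
  assumes n: "n > 0" and A: "A \<in> carrier_mat n n" and B: "B \<in> carrier_mat n n" and i: "i < n"
  shows "row_series n (A * B) i
    = (\<Sum>l<n. fls_shift (int i - int l) (fls_subst_power n (A $$ (i, l))) * row_series n B l)"
proof -
  let ?\<sigma> = "fls_subst_power n"
  have shift_sum: "fls_shift m (\<Sum>l<n. f l) = (\<Sum>l<n. fls_shift m (f l))"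
    for m and f :: "nat \<Rightarrow> 'a fls"
    by (rule fls_eqI) (simp add: fls_nth_sum)
  have "row_series n (A * B) i
      = (\<Sum>k<n. \<Sum>l<n. fls_shift (int i - int k) (?\<sigma> (A $$ (i, l)) * ?\<sigma> (B $$ (l, k))))"
    unfolding row_series_def
    by (intro sum.cong)
      (auto simp: index_mult_mat_sum[OF A B i] fls_subst_power_sum[OF n] fls_subst_power_mult[OF n]
        shift_sum simp del: index_mult_mat(1))
  also have "\<dots> = (\<Sum>l<n. \<Sum>k<n. fls_shift (int i - int l) (?\<sigma> (A $$ (i, l)))
      * fls_shift (int l - int k) (?\<sigma> (B $$ (l, k))))"
    by (subst sum.swap) (simp add: fls_times_both_shifted_simp)
  finally show ?thesis by (simp add: row_series_def sum_distrib_left)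
qed

lemma row_series_mult_const:
  assumes "n > 0" "A \<in> carrier_mat n n" "B \<in> carrier_mat n n" "i < n"
    and "\<And>l. l < n \<Longrightarrow> row_series n B l = g"
  shows "row_series n (A * B) i = row_series n A i * g"
  using assms row_series_mult[OF assms(1-4)] by (simp add: row_series_def[of n A] sum_distrib_right)

lemma row_series_pow_const:
  assumes A: "A \<in> carrier_mat n n" and rows: "\<And>l. l < n \<Longrightarrow> row_series n A l = g" and i: "i < n"
  shows "row_series n (A ^\<^sub>m j) i = g ^ j"
proof (induction j)
  case 0
  then show ?case using A row_series_one[OF i] by simp
next
  case (Suc j)
  then show ?case
    using row_series_mult_const[of n "A ^\<^sub>m j" A i g] A i rows by (simp add: mult.commute)
qed

lemma row_series_smult_one:
  assumes "i < n"
  shows "row_series n (c \<cdot>\<^sub>m 1\<^sub>m n) i = fls_subst_power n c"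
proof -
  have "row_series n (c \<cdot>\<^sub>m 1\<^sub>m n) i = (\<Sum>k<n. if k = i then fls_subst_power n c else 0)"
    unfolding row_series_def using assms by (intro sum.cong) auto
  then show ?thesis using assms by simp
qed


section \<open>The matrices \<open>J\<close> and \<open>J + u\<close>\<close>

definition spectral_V :: "nat \<Rightarrow> 'a::comm_ring_1 mat \<Rightarrow> 'a fls mat" where
  "spectral_V n u = fls_X_inv \<cdot>\<^sub>m elem_mat n 0 (n - 1) + map_mat fls_const u"

definition lax_mat :: "nat \<Rightarrow> 'a::comm_ring_1 mat \<Rightarrow> 'a fls mat" where
  "lax_mat n u = b_mat n + spectral_V n u"

lemma elem_mat_carrier [simp]: "elem_mat n i k \<in> carrier_mat n n"
  by (simp add: elem_mat_def)

lemma dim_elem_mat [simp]: "dim_row (elem_mat n i k) = n" "dim_col (elem_mat n i k) = n"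
  by (simp_all add: elem_mat_def)

lemma elem_mat_index: "r < n \<Longrightarrow> l < n \<Longrightarrow> elem_mat n i k $$ (r, l) = (if r = i \<and> l = k then 1 else 0)"
  by (simp add: elem_mat_def)

lemma spectral_V_in_V_mats:
  assumes "n \<ge> 2" "u \<in> V_mats n"
  shows "spectral_V n u \<in> V_mats n"
  using assms V_mats_carrier[OF assms(2)] V_mats_index_left[OF assms(2)]
    V_mats_corner[OF assms(2)]
  by (intro V_matsI) (auto simp: spectral_V_def elem_mat_index)

lemma lax_mat_carrier [simp]: "u \<in> carrier_mat n n \<Longrightarrow> lax_mat n u \<in> carrier_mat n n"
  by (simp add: lax_mat_def spectral_V_def)

lemma zero_in_V_mats [simp]: "0\<^sub>m n n \<in> V_mats n"
  by (simp add: V_mats_def)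

definition cyclic_pred :: "nat \<Rightarrow> nat \<Rightarrow> nat" where
  "cyclic_pred n i = (if i = 0 then n - 1 else i - 1)"

lemma cyclic_pred_less: "i < n \<Longrightarrow> cyclic_pred n i < n"
  by (auto simp: cyclic_pred_def)

lemma sum_cyclic_pred:
  fixes f :: "nat \<Rightarrow> 'a::comm_monoid_add"
  shows "(\<Sum>i<n. f (cyclic_pred n i)) = (\<Sum>i<n. f i)"
proof (cases n)
  case (Suc m)
  have "(\<Sum>i<n. f (cyclic_pred n i)) = f m + (\<Sum>i<m. f i)"
    unfolding Suc sum.lessThan_Suc_shift by (simp add: cyclic_pred_def)
  then show ?thesis by (simp add: Suc add.commute)
qed simp

lemma row_series_lax_mat_mult:
  assumes n: "n \<ge> 2" and u: "u \<in> V_mats n" and A: "A \<in> carrier_mat n n" and i: "i < n"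
  shows "row_series n (lax_mat n u * A) i
    = fls_X_inv * row_series n A (cyclic_pred n i)
      + fls_shift (int i - int (n - 1)) (fls_const (u $$ (i, n - 1))) * row_series n A (n - 1)"
proof -
  have n_pos: "n > 0" using n by simp
  let ?\<sigma> = "fls_subst_power n"
  let ?last_col = "fls_shift (int i - int (n - 1)) (?\<sigma> (spectral_V n u $$ (i, n - 1)))"
  note spectral_V = spectral_V_in_V_mats[OF n u]
  have entry: "spectral_V n u $$ (i, n - 1)
      = (if i = 0 then fls_X_inv else 0) + fls_const (u $$ (i, n - 1))"
    using i V_mats_carrier[OF u] by (simp add: spectral_V_def elem_mat_index)
  have "row_series n (lax_mat n u * A) i
      = (\<Sum>l<n. fls_shift (int i - int l) (?\<sigma> (lax_mat n u $$ (i, l))) * row_series n A l)"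
    using V_mats_carrier[OF u] by (intro row_series_mult n_pos lax_mat_carrier A i)
  also have "\<dots> = (\<Sum>l<n. (if i = Suc l then fls_shift 1 (row_series n A l) else 0)
      + (if l = n - 1 then ?last_col * row_series n A (n - 1) else 0))"
    unfolding lax_mat_def using i n_pos
    by (intro sum.cong)
      (auto simp: b_mat_add_V_mats_index[OF spectral_V i] fls_subst_power_add fls_subst_power_const
        distrib_right fls_X_inv_times_conv_shift fls_shifted_times_simps)
  also have "\<dots> = (if i = 0 then 0 else fls_shift 1 (row_series n A (i - 1)))
      + ?last_col * row_series n A (n - 1)"
    using i by (cases i) (simp_all add: sum.distrib)
  also have "\<dots> = fls_X_inv * row_series n A (cyclic_pred n i)
      + fls_shift (int i - int (n - 1)) (fls_const (u $$ (i, n - 1))) * row_series n A (n - 1)"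
    unfolding entry cyclic_pred_def using n_pos
    by (auto simp: fls_subst_power_add fls_subst_power_const fls_subst_power_X_inv
        fls_X_inv_times_conv_shift fls_shifted_times_simps distrib_right of_nat_diff)
  finally show ?thesis .
qed

lemma row_series_J:
  assumes n: "n \<ge> 2" and i: "i < n"
  shows "row_series n (lax_mat n (0\<^sub>m n n)) i = fls_X_inv"
  using row_series_lax_mat_mult[OF n zero_in_V_mats one_carrier_mat i] i n
  by (simp add: row_series_one cyclic_pred_less right_mult_one_mat[OF lax_mat_carrier])


section \<open>The dressing matrix\<close>

definition causal :: "('a fps \<Rightarrow> 'a fps) \<Rightarrow> bool" where
  "causal T \<longleftrightarrow>
    (\<forall>F G d. (\<forall>i\<le>d. fps_nth F i = fps_nth G i) \<longrightarrow> fps_nth (T F) d = fps_nth (T G) d)"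

lemma causalD:
  "causal T \<Longrightarrow> (\<And>i. i \<le> d \<Longrightarrow> fps_nth F i = fps_nth G i) \<Longrightarrow> fps_nth (T F) d = fps_nth (T G) d"
  unfolding causal_def by blast

lemma causal_id: "causal (\<lambda>F. F)"
  by (simp add: causal_def)

lemma causal_add: "causal S \<Longrightarrow> causal T \<Longrightarrow> causal (\<lambda>F. S F + T F)"
  for S T :: "'a::comm_ring_1 fps \<Rightarrow> 'a fps"
  unfolding causal_def by (metis fps_add_nth)

lemma causal_mult_left:
  fixes f :: "'a::comm_ring_1 fps"
  assumes T: "causal T"
  shows "causal (\<lambda>F. f * T F)"
  unfolding causal_def
proof (intro allI impI)
  fix F G :: "'a fps" and d
  assume "\<forall>i\<le>d. fps_nth F i = fps_nth G i"
  then have "fps_nth (T F) i = fps_nth (T G) i" if "i \<le> d" for i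
    using that by (intro causalD[OF T]) auto
  then show "fps_nth (f * T F) d = fps_nth (f * T G) d" by (simp add: fps_mult_nth)
qed

lemma causal_derivation: "causal T \<Longrightarrow> causal (\<lambda>F. \<partial> (T F))"
  for T :: "'a::differential_ring fps \<Rightarrow> 'a fps"
  unfolding causal_def by (metis fps_nth_derivation)

lemma exists_fps_derivation_eq:
  fixes T :: "'a::differential_ring fps \<Rightarrow> 'a fps"
  assumes surj: "surj (\<partial> :: 'a \<Rightarrow> 'a)" and T: "causal T"
  obtains F where "fps_nth F 0 = 1" "\<partial> F = fps_X * T F"
proof -
  define solves where "solves f d r \<longleftrightarrow>
    (if d = 0 then r = 1 else \<partial> r = fps_nth (T (Abs_fps f)) (d - 1))" for f d and r :: 'a
  have "\<exists>f. \<forall>d. solves f d (f d)"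
  proof (rule dependent_wellorder_choice)
    fix r and f g :: "nat \<Rightarrow> 'a" and d
    assume "\<And>i. i < d \<Longrightarrow> f i = g i"
    then have "fps_nth (T (Abs_fps f)) (d - 1) = fps_nth (T (Abs_fps g)) (d - 1)" if "d > 0"
      using that by (intro causalD[OF T]) auto
    then show "solves f d r = solves g d r" by (auto simp: solves_def)
  next
    fix f d
    show "\<exists>r. solves f d r"
      using surjD[OF surj, of "fps_nth (T (Abs_fps f)) (d - 1)"]
      by (cases "d = 0") (auto simp: solves_def)
  qed
  then obtain f where f: "\<And>d. solves f d (f d)" by blast
  have "fps_nth (\<partial> (Abs_fps f)) d = fps_nth (fps_X * T (Abs_fps f)) d" for d
    using f[of d] by (simp add: solves_def split: if_splits)
  then have "\<partial> (Abs_fps f) = fps_X * T (Abs_fps f)" by (rule fps_ext)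
  moreover have "fps_nth (Abs_fps f) 0 = 1" using f[of 0] by (simp add: solves_def)
  ultimately show ?thesis using that by blast
qed

text \<open>The rows of the dressing matrix from the bottom up, starting with \<open>F\<close>. The equation for
  the top row says that the recursion returns to \<open>F\<close> after \<open>n\<close> steps, that is, \<open>F\<close> is an
  eigenfunction of the scalar operator of order \<open>n\<close> with coefficients \<open>c\<close>.\<close>

primrec wave_row :: "(nat \<Rightarrow> 'a) \<Rightarrow> 'a fps \<Rightarrow> nat \<Rightarrow> 'a::differential_ring fps" where
  "wave_row c F 0 = F"
| "wave_row c F (Suc k) = wave_row c F k - fps_X * \<partial> (wave_row c F k)
     - fps_X ^ Suc k * (fps_const (c k) * F)"

lemma wave_row_nth_0: "fps_nth (wave_row c F k) 0 = fps_nth F 0"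
  by (induction k) simp_all

lemma wave_row_expansion:
  fixes c :: "nat \<Rightarrow> 'a::differential_ring"
  assumes "c 0 = 0"
  shows "\<exists>R. causal R \<and>
    (\<forall>F. wave_row c F k = F - of_nat k * (fps_X * \<partial> F) + fps_X\<^sup>2 * R F)"
proof (induction k)
  case 0
  show ?case by (rule exI[of _ "\<lambda>F. 0"]) (simp add: causal_def)
next
  case (Suc k)
  then obtain R where causal_R: "causal R"
    and IH: "\<And>F. wave_row c F k = F - of_nat k * (fps_X * \<partial> F) + fps_X\<^sup>2 * R F" by blast
  define R' where "R' F = R F + of_nat k * \<partial> (\<partial> F) + (- fps_X) * \<partial> (R F)
    + (- (fps_X ^ (k - 1) * fps_const (c k))) * F" for F
  have "causal R'"
    unfolding R'_def by (intro causal_add causal_mult_left causal_derivation causal_id causal_R)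
  moreover have "fps_X ^ Suc k * (fps_const (c k) * F)
      = fps_X\<^sup>2 * (fps_X ^ (k - 1) * fps_const (c k) * F)" for F
    using assms by (cases k) (simp_all add: power2_eq_square mult.assoc)
  then have "wave_row c F (Suc k) = F - of_nat (Suc k) * (fps_X * \<partial> F) + fps_X\<^sup>2 * R' F" for F
    by (simp add: IH R'_def derivation_add derivation_diff derivation_mult power2_eq_square
        algebra_simps)
  ultimately show ?case by blast
qed

lemma exists_wave_function:
  fixes c :: "nat \<Rightarrow> 'a::differential_ring"
  assumes surj: "surj (\<partial> :: 'a \<Rightarrow> 'a)" and unit: "of_nat n dvd (1 :: 'a)" and "c 0 = 0"
  obtains F where "fps_nth F 0 = 1" "wave_row c F n = F"
proof -
  obtain r where r: "1 = of_nat n * (r :: 'a)" using unit by (elim dvdE)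
  obtain R where causal_R: "causal R"
    and row_n: "\<And>F. wave_row c F n = F - of_nat n * (fps_X * \<partial> F) + fps_X\<^sup>2 * R F"
    using wave_row_expansion[of c n] \<open>c 0 = 0\<close> by blast
  obtain F where "fps_nth F 0 = 1" and deriv_F: "\<partial> F = fps_X * (fps_const r * R F)"
    using exists_fps_derivation_eq[OF surj causal_mult_left[OF causal_R, of "fps_const r"]] by blast
  have "of_nat n * fps_const r = (1 :: 'a fps)"
    using r by (simp flip: fps_of_nat)
  then have "of_nat n * (fps_X * \<partial> F) = fps_X\<^sup>2 * R F"
    unfolding deriv_F power2_eq_square by (metis mult.assoc mult.left_commute mult_1)
  then show ?thesis using that \<open>fps_nth F 0 = 1\<close> row_n by simp
qed

lemma exists_dressing_rows:
  fixes u :: "'a::differential_ring mat"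
  assumes surj: "surj (\<partial> :: 'a \<Rightarrow> 'a)" and unit: "of_nat n dvd (1 :: 'a)"
    and n: "n > 0" and u: "u \<in> V_mats n"
  obtains H :: "nat \<Rightarrow> 'a fps" where "\<And>i. fps_nth (H i) 0 = 1"
    "\<And>i. i < n \<Longrightarrow> H (cyclic_pred n i)
      = H i - fps_X * \<partial> (H i) - fps_X ^ (n - i) * (fps_const (u $$ (i, n - 1)) * H (n - 1))"
proof -
  define c where "c k = u $$ (n - 1 - k, n - 1)" for k
  obtain F where F_0: "fps_nth F 0 = 1" and F_n: "wave_row c F n = F"
    using exists_wave_function[OF surj unit, of c] V_mats_corner[OF u n] by (auto simp: c_def)
  define H where "H i = wave_row c F (n - 1 - i)" for i
  have "H (cyclic_pred n i)
      = H i - fps_X * \<partial> (H i) - fps_X ^ (n - i) * (fps_const (u $$ (i, n - 1)) * H (n - 1))"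
    if i: "i < n" for i
  proof -
    have "H (cyclic_pred n i) = wave_row c F (Suc (n - 1 - i))"
      using i F_n
      by (auto simp: H_def cyclic_pred_def Suc_diff_Suc simp del: wave_row.simps(2))
    moreover have "Suc (n - 1 - i) = n - i" "n - 1 - (n - 1 - i) = i" using i by auto
    ultimately show ?thesis
      unfolding wave_row.simps(2) by (simp only: H_def c_def diff_self_eq_0 wave_row.simps(1))
  qed
  moreover have "fps_nth (H i) 0 = 1" for i by (simp add: H_def wave_row_nth_0 F_0)
  ultimately show ?thesis using that by blast
qed

lemma dressing_rows:
  fixes u :: "'a::differential_ring mat"
  assumes surj: "surj (\<partial> :: 'a \<Rightarrow> 'a)" and unit: "of_nat n dvd (1 :: 'a)"
    and n: "n \<ge> 2" and u: "u \<in> V_mats n"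
  obtains M H where "M \<in> carrier_mat n n" "intertwines (lax_mat n u) (lax_mat n (0\<^sub>m n n)) M"
    "\<And>i. i < n \<Longrightarrow> row_series n M i = fps_to_fls (H i)" "\<And>i. fps_nth (H i) 0 = 1"
proof -
  have n_pos: "n > 0" using n by simp
  obtain H :: "nat \<Rightarrow> 'a fps" where H_0: "\<And>i. fps_nth (H i) 0 = 1"
    and H_pred: "\<And>i. i < n \<Longrightarrow> H (cyclic_pred n i)
      = H i - fps_X * \<partial> (H i) - fps_X ^ (n - i) * (fps_const (u $$ (i, n - 1)) * H (n - 1))"
    using exists_dressing_rows[OF surj unit n_pos u] by blast
  obtain M where M: "M \<in> carrier_mat n n"
    and rows: "\<And>i. i < n \<Longrightarrow> row_series n M i = fps_to_fls (H i)"
    using row_series_surj[OF n_pos, of "\<lambda>i. fps_to_fls (H i)"] by blast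
  have lax: "lax_mat n (0\<^sub>m n n) \<in> carrier_mat n n" "lax_mat n u \<in> carrier_mat n n"
    using V_mats_carrier[OF u] by simp_all
  have "intertwines (lax_mat n u) (lax_mat n (0\<^sub>m n n)) M"
    unfolding intertwines_def
  proof (rule row_series_eqI)
    fix i assume i: "i < n"
    have "fls_X_inv * fps_to_fls (H (cyclic_pred n i))
        = fls_X_inv * fps_to_fls (H i) - \<partial> (fps_to_fls (H i))
          - fls_shift (int i - int (n - 1)) (fls_const (u $$ (i, n - 1))) * fps_to_fls (H (n - 1))"
      unfolding H_pred[OF i] using i
      by (simp add: right_diff_distrib fls_times_fps_to_fls derivation_fps_to_fls fps_to_fls_power
          fls_X_inv_times_conv_shift fls_X_times_conv_shift fls_X_power_times_conv_shift
          fls_shifted_times_simps of_nat_diff algebra_simps)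
    then show "row_series n (map_mat \<partial> M + lax_mat n u * M) i
        = row_series n (M * lax_mat n (0\<^sub>m n n)) i"
      using i n_pos M rows lax
      by (simp add: cyclic_pred_less row_series_add row_series_derivation
          row_series_lax_mat_mult[OF n u M i]
          row_series_mult_const[OF n_pos M lax(1) i row_series_J[OF n]] mult.commute)
  qed (use M lax in simp_all)
  then show ?thesis using that M rows H_0 by blast
qed

abbreviation mat_const_term :: "'a::zero fps mat \<Rightarrow> 'a mat" where
  "mat_const_term \<equiv> map_mat (\<lambda>f. fps_nth f 0)"

interpretation fps_nth_0: comm_ring_hom "\<lambda>f :: 'a::comm_ring_1 fps. fps_nth f 0"
  by unfold_locales auto

interpretation fps_to_fls: comm_ring_hom "fps_to_fls :: 'a::comm_ring_1 fps \<Rightarrow> 'a fls"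
  by unfold_locales (auto simp: fls_times_fps_to_fls)

definition unitriangular :: "'a::comm_ring_1 mat \<Rightarrow> bool" where
  "unitriangular A \<longleftrightarrow> (\<forall>i<dim_row A. \<forall>k\<le>i. A $$ (i, k) = (if i = k then 1 else 0))"

lemma det_unitriangular:
  assumes A: "A \<in> carrier_mat n n" and "unitriangular A"
  shows "det A = 1"
proof -
  have "upper_triangular A" using assms by (auto simp: unitriangular_def upper_triangular_def)
  then have "det A = prod_list (diag_mat A)" by (rule det_upper_triangular[OF _ A])
  also have "diag_mat A = map (\<lambda>i. 1) [0..<n]"
    using assms by (auto simp: unitriangular_def diag_mat_def)
  finally show ?thesis by (simp add: map_replicate_const)
qed

lemma mat_of_unitriangular_rows:
  assumes M: "M \<in> carrier_mat n n" and rows: "\<And>i. i < n \<Longrightarrow> row_series n M i = fps_to_fls (H i)"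
    and H_0: "\<And>i. fps_nth (H i) 0 = 1"
  obtains A where "A \<in> carrier_mat n n" "M = map_mat fps_to_fls A"
    "unitriangular (mat_const_term A)"
proof -
  have entry: "fls_nth (M $$ (i, k)) q = fls_nth (fps_to_fls (H i)) (int n * q + int k - int i)"
    if "i < n" "k < n" for i k q
    using that by (simp add: fls_nth_mat_index rows)
  have "M $$ (i, k) = fps_to_fls (fls_regpart (M $$ (i, k)))" if ik: "i < n" "k < n" for i k
  proof (rule fls_eqI)
    fix q
    have "int n * q \<le> int n * (- 1)" if "q < 0" using that by (intro mult_left_mono) auto
    then have "fls_nth (M $$ (i, k)) q = 0" if "q < 0" using that ik by (simp add: entry)
    then show "fls_nth (M $$ (i, k)) q = fls_nth (fps_to_fls (fls_regpart (M $$ (i, k)))) q" by simp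
  qed
  then have "M = map_mat fps_to_fls (map_mat fls_regpart M)" using M by (intro eq_matI) auto
  moreover have "unitriangular (mat_const_term (map_mat fls_regpart M))"
    using M H_0 by (auto simp: unitriangular_def entry)
  moreover have "map_mat fls_regpart M \<in> carrier_mat n n" using M by simp
  ultimately show ?thesis using that by blast
qed

lemma fps_mat_inverse:
  fixes A :: "'a::comm_ring_1 fps mat"
  assumes A: "A \<in> carrier_mat n n" and det: "det (mat_const_term A) = 1"
  obtains B where "B \<in> carrier_mat n n" "A * B = 1\<^sub>m n" "B * A = 1\<^sub>m n"
proof -
  define c where "c = fps_right_inverse (det A) 1"
  have c: "det A * c = 1" using det unfolding c_def by (intro fps_right_inverse) simp
  note adj = adj_mat[OF A]
  have "A * (c \<cdot>\<^sub>m adj_mat A) = 1\<^sub>m n" "(c \<cdot>\<^sub>m adj_mat A) * A = 1\<^sub>m n"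
    unfolding mult_smult_distrib[OF A adj(1)] mult_smult_assoc_mat[OF adj(1) A] adj(2,3)
    using c by (auto intro!: eq_matI simp: mult.commute)
  then show ?thesis using adj(1) by (intro that[of "c \<cdot>\<^sub>m adj_mat A"]) simp_all
qed

definition fixes_corner :: "nat \<Rightarrow> 'a::comm_ring_1 mat \<Rightarrow> bool" where
  "fixes_corner n A \<longleftrightarrow> A * elem_mat n 0 (n - 1) = elem_mat n 0 (n - 1) \<and>
     elem_mat n 0 (n - 1) * A = elem_mat n 0 (n - 1)"

lemma fixes_corner_unitriangular:
  fixes A :: "'a::comm_ring_1 mat"
  assumes A: "A \<in> carrier_mat n n" and tri: "unitriangular A"
  shows "fixes_corner n A"
proof -
  let ?e = "elem_mat n 0 (n - 1) :: 'a mat"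
  have tri: "A $$ (i, k) = (if i = k then 1 else 0)" if "k \<le> i" "i < n" for i k
    using that A tri by (simp add: unitriangular_def)
  have "(A * ?e) $$ (i, k) = ?e $$ (i, k)" if ik: "i < n" "k < n" for i k
  proof -
    have "(A * ?e) $$ (i, k) = (\<Sum>l<n. if l = 0 then A $$ (i, 0) * ?e $$ (0, k) else 0)"
      unfolding index_mult_mat_sum[OF A elem_mat_carrier ik]
      using ik by (intro sum.cong) (auto simp: elem_mat_index)
    then show ?thesis using ik by (auto simp: tri elem_mat_index)
  qed
  then have "A * ?e = ?e" using A by (intro eq_matI) (auto simp del: index_mult_mat(1))
  moreover have "(?e * A) $$ (i, k) = ?e $$ (i, k)" if ik: "i < n" "k < n" for i k
  proof -
    have "(?e * A) $$ (i, k) = (\<Sum>l<n. if l = n - 1 then ?e $$ (i, n - 1) * A $$ (n - 1, k) else 0)"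
      unfolding index_mult_mat_sum[OF elem_mat_carrier A ik]
      using ik by (intro sum.cong) (auto simp: elem_mat_index)
    then show ?thesis using ik tri[of k "n - 1"] by (auto simp: elem_mat_index)
  qed
  then have "?e * A = ?e" using A by (intro eq_matI) (auto simp del: index_mult_mat(1))
  ultimately show ?thesis by (simp add: fixes_corner_def)
qed

lemma fixes_corner_inverse:
  fixes A B :: "'a::comm_ring_1 mat"
  assumes carrier: "A \<in> carrier_mat n n" "B \<in> carrier_mat n n"
    and AB: "A * B = 1\<^sub>m n" and BA: "B * A = 1\<^sub>m n" and A: "fixes_corner n A"
  shows "fixes_corner n B"
proof -
  let ?e = "elem_mat n 0 (n - 1) :: 'a mat"
  have "B * ?e = ?e"
    using assoc_mult_mat[OF carrier(2,1) elem_mat_carrier, of 0 "n - 1"] A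
    by (simp add: BA fixes_corner_def)
  moreover have "?e * B = ?e"
    using assoc_mult_mat[OF elem_mat_carrier carrier, of 0 "n - 1"] A
    by (simp add: AB fixes_corner_def)
  ultimately show ?thesis by (simp add: fixes_corner_def)
qed

lemma dressing_matrix:
  fixes u :: "'a::differential_ring mat"
  assumes surj: "surj (\<partial> :: 'a \<Rightarrow> 'a)" and unit: "of_nat n dvd (1 :: 'a)"
    and n: "n \<ge> 2" and u: "u \<in> V_mats n"
  obtains A B where "A \<in> carrier_mat n n" "B \<in> carrier_mat n n" "A * B = 1\<^sub>m n" "B * A = 1\<^sub>m n"
    "fixes_corner n (mat_const_term A)" "fixes_corner n (mat_const_term B)"
    "intertwines (lax_mat n u) (lax_mat n (0\<^sub>m n n)) (map_mat fps_to_fls A)"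
proof -
  obtain M H where M: "M \<in> carrier_mat n n" "intertwines (lax_mat n u) (lax_mat n (0\<^sub>m n n)) M"
    and rows: "\<And>i. i < n \<Longrightarrow> row_series n M i = fps_to_fls (H i)" "\<And>i. fps_nth (H i) 0 = 1"
    using dressing_rows[OF surj unit n u] by blast
  obtain A where A: "A \<in> carrier_mat n n" "M = map_mat fps_to_fls A"
    and tri: "unitriangular (mat_const_term A)"
    using mat_of_unitriangular_rows[OF M(1) rows] by blast
  have A_0: "mat_const_term A \<in> carrier_mat n n" using A(1) by simp
  obtain B where B: "B \<in> carrier_mat n n" "A * B = 1\<^sub>m n" "B * A = 1\<^sub>m n"
    using fps_mat_inverse[OF A(1) det_unitriangular[OF A_0 tri]] by blast
  have corner_A: "fixes_corner n (mat_const_term A)"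
    by (rule fixes_corner_unitriangular[OF A_0 tri])
  have B_0: "mat_const_term B \<in> carrier_mat n n" using B(1) by simp
  have "mat_const_term A * mat_const_term B = 1\<^sub>m n" "mat_const_term B * mat_const_term A = 1\<^sub>m n"
    using fps_nth_0.mat_hom_mult[OF A(1) B(1)] fps_nth_0.mat_hom_mult[OF B(1) A(1)]
    by (simp_all add: B fps_nth_0.mat_hom_one)
  then have "fixes_corner n (mat_const_term B)"
    using corner_A by (rule fixes_corner_inverse[OF A_0 B_0])
  then show ?thesis using that A B M(2) corner_A by blast
qed


section \<open>The series \<open>Y(u,\<lambda>)\<close> over a differential ring\<close>

definition has_J_leading :: "nat \<Rightarrow> 'a::comm_ring_1 fls mat \<Rightarrow> bool" where
  "has_J_leading n Y \<longleftrightarrow> Y \<in> carrier_mat n n \<and>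
     (\<forall>i<n. \<forall>k<n. (\<forall>m. m < - 1 \<longrightarrow> fls_nth (Y $$ (i, k)) m = 0) \<and>
       fls_nth (Y $$ (i, k)) (- 1) = elem_mat n 0 (n - 1) $$ (i, k))"

definition is_lax_root :: "nat \<Rightarrow> 'a::differential_ring mat \<Rightarrow> 'a fls mat \<Rightarrow> bool" where
  "is_lax_root n u Y \<longleftrightarrow> has_J_leading n Y \<and> covariant_deriv (lax_mat n u) Y = 0\<^sub>m n n \<and>
     Y ^\<^sub>m n = fls_X_inv \<cdot>\<^sub>m 1\<^sub>m n"

lemma is_lax_root_carrier: "is_lax_root n u Y \<Longrightarrow> Y \<in> carrier_mat n n"
  by (simp add: is_lax_root_def has_J_leading_def)

lemma is_lax_root_intertwines:
  assumes "is_lax_root n u Y" "u \<in> carrier_mat n n"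
  shows "intertwines (lax_mat n u) (lax_mat n u) Y"
  using covariant_deriv_eq_0_iff[OF lax_mat_carrier[OF assms(2)] is_lax_root_carrier[OF assms(1)]]
    assms(1) by (simp add: is_lax_root_def)

lemma has_J_leading_iff_fps:
  "has_J_leading n Y \<longleftrightarrow> (\<exists>P\<in>carrier_mat n n. Y = fls_X_inv \<cdot>\<^sub>m map_mat fps_to_fls P \<and>
     mat_const_term P = elem_mat n 0 (n - 1))"
proof
  assume Y: "has_J_leading n Y"
  then have carrier: "Y \<in> carrier_mat n n" by (simp add: has_J_leading_def)
  define P where "P = map_mat (\<lambda>f. fls_regpart (fls_X * f)) Y"
  have "Y $$ (i, k) = fls_X_inv * fps_to_fls (P $$ (i, k))" if "i < n" "k < n" for i k
    using Y that
    by (intro fls_eqI)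
      (auto simp: P_def has_J_leading_def fls_X_times_conv_shift fls_X_inv_times_conv_shift)
  then have "Y = fls_X_inv \<cdot>\<^sub>m map_mat fps_to_fls P"
    using carrier by (intro eq_matI) (auto simp: P_def)
  moreover have "mat_const_term P = elem_mat n 0 (n - 1)"
    using Y by (intro eq_matI) (auto simp: P_def has_J_leading_def fls_X_times_conv_shift)
  moreover have "P \<in> carrier_mat n n" using carrier by (simp add: P_def)
  ultimately show "\<exists>P\<in>carrier_mat n n. Y = fls_X_inv \<cdot>\<^sub>m map_mat fps_to_fls P \<and>
     mat_const_term P = elem_mat n 0 (n - 1)" by blast
next
  assume "\<exists>P\<in>carrier_mat n n. Y = fls_X_inv \<cdot>\<^sub>m map_mat fps_to_fls P \<and>
     mat_const_term P = elem_mat n 0 (n - 1)"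
  then obtain P where P: "P \<in> carrier_mat n n" "Y = fls_X_inv \<cdot>\<^sub>m map_mat fps_to_fls P"
    and lead: "mat_const_term P = elem_mat n 0 (n - 1)" by blast
  have "fps_nth (P $$ (i, k)) 0 = elem_mat n 0 (n - 1) $$ (i, k)" if "i < n" "k < n" for i k
    using arg_cong[OF lead, of "\<lambda>A. A $$ (i, k)"] P(1) that by simp
  then show "has_J_leading n Y"
    using P by (auto simp: has_J_leading_def fls_X_inv_times_conv_shift)
qed

lemma has_J_leading_conj:
  fixes A B :: "'a::comm_ring_1 fps mat"
  assumes A: "A \<in> carrier_mat n n" "fixes_corner n (mat_const_term A)"
    and B: "B \<in> carrier_mat n n" "fixes_corner n (mat_const_term B)"
    and Y: "has_J_leading n Y"
  shows "has_J_leading n (map_mat fps_to_fls A * Y * map_mat fps_to_fls B)"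
proof -
  let ?\<iota> = "map_mat (fps_to_fls :: 'a fps \<Rightarrow> 'a fls)"
  obtain P where P: "P \<in> carrier_mat n n" "Y = fls_X_inv \<cdot>\<^sub>m ?\<iota> P"
    and lead: "mat_const_term P = elem_mat n 0 (n - 1)"
    using Y unfolding has_J_leading_iff_fps by blast
  have AP: "A * P \<in> carrier_mat n n" using A P by simp
  have carrier: "?\<iota> A \<in> carrier_mat n n" "?\<iota> P \<in> carrier_mat n n" "?\<iota> B \<in> carrier_mat n n"
    using A B P by auto
  have "?\<iota> A * Y * ?\<iota> B = fls_X_inv \<cdot>\<^sub>m ?\<iota> (A * P * B)"
    unfolding P(2) mult_smult_distrib[OF carrier(1,2)] fps_to_fls.mat_hom_mult[OF AP B(1)]
      fps_to_fls.mat_hom_mult[OF A(1) P(1)]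
    by (rule mult_smult_assoc_mat[OF mult_carrier_mat[OF carrier(1,2)] carrier(3)])
  moreover have "mat_const_term (A * P * B) = elem_mat n 0 (n - 1)"
    unfolding fps_nth_0.mat_hom_mult[OF AP B(1)] fps_nth_0.mat_hom_mult[OF A(1) P(1)] lead
    using A(2) B(2) by (simp add: fixes_corner_def)
  moreover have "A * P * B \<in> carrier_mat n n" using AP B(1) by simp
  ultimately show ?thesis unfolding has_J_leading_iff_fps by blast
qed

lemma is_lax_root_conj:
  fixes A B :: "'a::differential_ring fps mat"
  assumes carrier: "A \<in> carrier_mat n n" "B \<in> carrier_mat n n"
      "u \<in> carrier_mat n n" "w \<in> carrier_mat n n"
    and inverse: "A * B = 1\<^sub>m n" "B * A = 1\<^sub>m n"
    and corner: "fixes_corner n (mat_const_term A)" "fixes_corner n (mat_const_term B)"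
    and A: "intertwines (lax_mat n u) (lax_mat n w) (map_mat fps_to_fls A)"
    and Y: "is_lax_root n w Y"
  shows "is_lax_root n u (map_mat fps_to_fls A * Y * map_mat fps_to_fls B)"
proof -
  define M N where "M = map_mat fps_to_fls A" and "N = map_mat fps_to_fls B"
  have MN: "M \<in> carrier_mat n n" "N \<in> carrier_mat n n" using carrier by (simp_all add: M_def N_def)
  have MN_inverse: "M * N = 1\<^sub>m n" "N * M = 1\<^sub>m n"
    using fps_to_fls.mat_hom_mult[OF carrier(1,2)] fps_to_fls.mat_hom_mult[OF carrier(2,1)]
    by (simp_all add: M_def N_def inverse fps_to_fls.mat_hom_one)
  have lax: "lax_mat n u \<in> carrier_mat n n" "lax_mat n w \<in> carrier_mat n n"
    using carrier by simp_all
  have Y_carrier: "Y \<in> carrier_mat n n" using Y by (rule is_lax_root_carrier)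
  have MYN: "M * Y * N \<in> carrier_mat n n" using MN Y_carrier by simp
  have "intertwines (lax_mat n w) (lax_mat n u) N"
    using A by (intro intertwines_inverse[OF lax MN MN_inverse]) (simp add: M_def)
  then have "intertwines (lax_mat n u) (lax_mat n u) (M * Y * N)"
    using A is_lax_root_intertwines[OF Y carrier(4)] lax MN Y_carrier unfolding M_def[symmetric]
    by (intro intertwines_mult[of _ n "lax_mat n w"] mult_carrier_mat) auto
  then have "covariant_deriv (lax_mat n u) (M * Y * N) = 0\<^sub>m n n"
    using covariant_deriv_eq_0_iff[OF lax(1) MYN] by simp
  moreover have "(M * Y * N) ^\<^sub>m n = M * Y ^\<^sub>m n * N"
    using MN Y_carrier MN_inverse by (intro similar_mat_wit_pow_id similar_mat_witI) auto
  then have "(M * Y * N) ^\<^sub>m n = fls_X_inv \<cdot>\<^sub>m 1\<^sub>m n"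
    using Y MN MN_inverse by (simp add: is_lax_root_def mult_smult_distrib[OF MN(1) one_carrier_mat]
        mult_smult_assoc_mat[OF MN])
  moreover have "has_J_leading n (M * Y * N)"
    using has_J_leading_conj[OF carrier(1) corner(1) carrier(2) corner(2)] Y
    by (simp add: is_lax_root_def M_def N_def)
  ultimately show ?thesis by (simp add: is_lax_root_def M_def N_def)
qed

lemma is_lax_root_J:
  assumes n: "n \<ge> 2"
  shows "is_lax_root n (0\<^sub>m n n) (lax_mat n (0\<^sub>m n n :: 'a::differential_ring mat))"
proof -
  let ?J = "lax_mat n (0\<^sub>m n n :: 'a mat)"
  have carrier: "?J \<in> carrier_mat n n" by simp
  have index: "?J $$ (i, k)
      = (if i = Suc k then 1 else 0) + fls_X_inv * elem_mat n 0 (n - 1) $$ (i, k)"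
    if "i < n" "k < n" for i k
    using that by (simp add: lax_mat_def spectral_V_def b_mat_index)
  have "has_J_leading n ?J"
    by (simp add: has_J_leading_def index fls_X_inv_times_conv_shift elem_mat_index)
  moreover have "map_mat \<partial> ?J = 0\<^sub>m n n"
    by (rule eq_matI)
      (auto simp: index derivation_add elem_mat_index carrier_matD[OF carrier] intro!: fls_eqI)
  then have "intertwines ?J ?J ?J"
    using left_add_zero_mat[OF mult_carrier_mat[OF carrier carrier]] by (simp add: intertwines_def)
  moreover have "?J ^\<^sub>m n = fls_X_inv \<cdot>\<^sub>m 1\<^sub>m n"
    using n by (intro row_series_eqI[of _ n])
      (simp_all add: row_series_pow_const[OF carrier row_series_J[OF n]] row_series_smult_one
        fls_subst_power_X_inv fls_X_inv_power_conv_shift_1)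
  ultimately show ?thesis
    using covariant_deriv_eq_0_iff[OF carrier carrier] by (simp add: is_lax_root_def)
qed

lemma mat_trace_J_pow:
  assumes n: "n \<ge> 2" and j: "\<not> n dvd j"
  shows "mat_trace (lax_mat n (0\<^sub>m n n :: 'a::comm_ring_1 mat) ^\<^sub>m j) = 0"
proof -
  let ?J = "lax_mat n (0\<^sub>m n n :: 'a mat)"
  have carrier: "?J \<in> carrier_mat n n" by simp
  have "(?J ^\<^sub>m j) $$ (i, i) = 0" if i: "i < n" for i
  proof (rule fls_eqI)
    fix q
    have "int n * q \<noteq> - int j" using j by (metis dvd_minus_iff dvd_triv_left int_dvd_int_iff)
    then show "fls_nth ((?J ^\<^sub>m j) $$ (i, i)) q = fls_nth 0 q"
      using i by (simp add: fls_nth_mat_index row_series_pow_const[OF carrier row_series_J[OF n]])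
  qed
  then show ?thesis using carrier_matD[OF carrier] by (simp add: mat_trace_def)
qed

lemma cyclic_pred_invariant_imp_const:
  assumes "\<And>i. i < n \<Longrightarrow> a (cyclic_pred n i) = a i" and "i < n"
  shows "a i = a 0"
  using assms(2)
proof (induction i)
  case (Suc i)
  then show ?case using assms(1)[of "Suc i"] by (simp add: cyclic_pred_def)
qed simp

lemma derivation_eq_cyclic_difference_imp_0:
  fixes x :: "'a::differential_ring"
  assumes unit: "of_nat n dvd (1 :: 'a)"
    and diff: "\<And>i. i < n \<Longrightarrow> \<partial> x + a (cyclic_pred n i) = a i"
  shows "\<partial> x = 0"
proof -
  obtain r where r: "1 = of_nat n * (r :: 'a)" using unit by (elim dvdE)
  have "(\<Sum>i<n. \<partial> x) = (\<Sum>i<n. a i - a (cyclic_pred n i))"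
    using diff by (intro sum.cong) (simp_all add: eq_diff_eq)
  also have "\<dots> = 0" by (simp add: sum_subtractf sum_cyclic_pred)
  finally have "r * (of_nat n * \<partial> x) = 0" by simp
  then show ?thesis by (metis r mult.assoc mult.commute mult_1)
qed

lemma fls_nth_cyclic_derivation_rows:
  fixes q :: "nat \<Rightarrow> 'a::differential_ring fls"
  assumes "\<And>i. i < n \<Longrightarrow> \<partial> (q i) + fls_X_inv * q (cyclic_pred n i) = fls_X_inv * q i"
    and "i < n"
  shows "\<partial> (fls_nth (q i) (m - 1)) + fls_nth (q (cyclic_pred n i)) m = fls_nth (q i) m"
  using arg_cong[OF assms(1)[OF assms(2)], of "\<lambda>f. fls_nth f (m - 1)"]
  by (simp add: fls_X_inv_times_conv_shift)

lemma cyclic_derivation_rows_equal: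
  fixes q :: "nat \<Rightarrow> 'a::differential_ring fls"
  assumes unit: "of_nat n dvd (1 :: 'a)"
    and rows: "\<And>i. i < n \<Longrightarrow> \<partial> (q i) + fls_X_inv * q (cyclic_pred n i) = fls_X_inv * q i"
    and i: "i < n"
  shows "q i = q 0"
proof -
  define const where "const m \<longleftrightarrow> (\<forall>i<n. \<partial> (fls_nth (q i) m) = 0)" for m
  have coeff: "\<partial> (fls_nth (q i) (m - 1)) + fls_nth (q (cyclic_pred n i)) m = fls_nth (q i) m"
    if "i < n" for i m
    using rows that by (rule fls_nth_cyclic_derivation_rows)
  have equal: "fls_nth (q i) m = fls_nth (q 0) m" if "const (m - 1)" "i < n" for i m
    using that coeff[of _ m] unfolding const_def
    by (intro cyclic_pred_invariant_imp_const[of n "\<lambda>i. fls_nth (q i) m"]) auto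
  have const_step: "const m" if "const (m - 1)" for m
  proof -
    have "\<partial> (fls_nth (q 0) m) + fls_nth (q (cyclic_pred n i)) (m + 1) = fls_nth (q i) (m + 1)"
      if "i < n" for i
      using coeff[OF that, of "m + 1"] equal[OF \<open>const (m - 1)\<close> that] by simp
    then have "\<partial> (fls_nth (q 0) m) = 0"
      by (rule derivation_eq_cyclic_difference_imp_0[OF unit])
    then show ?thesis using equal[OF that] unfolding const_def by metis
  qed
  define N where "N = Min ((\<lambda>i. fls_subdegree (q i)) ` {..<n})"
  have "N \<le> fls_subdegree (q i)" if "i < n" for i
    unfolding N_def using that by (intro Min_le) auto
  then have "fls_nth (q i) m = 0" if "m < N" "i < n" for i m
    using that by (meson fls_eq0_below_subdegree order.strict_trans2)
  then have const_below: "const m" if "m < N" for m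
    using that by (simp add: const_def)
  have const_above: "const m" if "N - 1 \<le> m" for m
    using that
  proof (induction m rule: int_ge_induct)
    case (step m)
    then show ?case using const_step[of "m + 1"] by simp
  qed (simp add: const_below)
  have "const m" for m using const_below const_above by (cases "m < N") auto
  then show ?thesis using equal[OF _ i] by (intro fls_eqI) blast
qed

lemma fps_unipotent_root_of_unity:
  fixes f :: "'a::comm_ring_1 fps"
  assumes unit: "of_nat n dvd (1 :: 'a)" and f_0: "fps_nth f 0 = 1" and pow: "f ^ n = 1"
  shows "f = 1"
proof -
  obtain r where r: "1 = of_nat n * (r :: 'a)" using unit by (elim dvdE)
  let ?s = "\<Sum>i<n. f ^ i"
  have "fps_nth ?s 0 * r = 1" using r by (simp add: fps_sum_nth fps_nth_power_0 f_0)
  then have inverse: "?s * fps_right_inverse ?s r = 1" by (rule fps_right_inverse)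
  have "(f - 1) * ?s = 0" using power_diff_1_eq[of f n] pow by simp
  then have "(f - 1) * (?s * fps_right_inverse ?s r) = 0" by (simp flip: mult.assoc)
  then show ?thesis by (simp add: inverse)
qed

lemma fls_X_inv_unique_root:
  fixes f :: "'a::comm_ring_1 fls"
  assumes unit: "of_nat n dvd (1 :: 'a)"
    and principal: "\<And>m. m < 0 \<Longrightarrow> fls_nth f m = (if m = - 1 then 1 else 0)"
    and pow: "f ^ n = fls_X_inv ^ n"
  shows "f = fls_X_inv"
proof -
  define w where "w = fls_regpart (fls_X * f)"
  have w: "fls_X * f = fps_to_fls w"
    using principal by (intro fls_eqI) (auto simp: w_def fls_X_times_conv_shift)
  have X_inverse: "fls_X * fls_X_inv = (1 :: 'a fls)"
    by (simp add: fls_X_times_conv_shift fls_X_inv_conv_shift_1)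
  have "fps_to_fls (w ^ n) = (fls_X * fls_X_inv) ^ n"
    by (simp add: fps_to_fls_power pow power_mult_distrib flip: w)
  then have "fps_to_fls (w ^ n) = fps_to_fls 1" by (simp add: X_inverse)
  then have "w ^ n = 1" by (simp only: fps_to_fls_eq_iff)
  moreover have "fps_nth w 0 = 1" using principal by (simp add: w_def fls_X_times_conv_shift)
  ultimately have "fls_X * f = 1" using fps_unipotent_root_of_unity[OF unit] w by simp
  then have "fls_X_inv * (fls_X * f) = fls_X_inv" by simp
  then show ?thesis using X_inverse by (simp add: mult.commute flip: mult.assoc)
qed

lemma has_J_leading_row_series_0:
  assumes n: "n > 0" and Y: "has_J_leading n Y" and m: "m < 0"
  shows "fls_nth (row_series n Y 0) m = (if m = - 1 then 1 else 0)"
proof -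
  define k where "k = nat (m mod int n)"
  have k: "k < n" "int k = m mod int n" using n by (auto simp: k_def nat_less_iff)
  have coeff: "fls_nth (row_series n Y 0) m = fls_nth (Y $$ (0, k)) (m div int n)"
    using n by (simp add: row_series_nth k_def)
  have "m div int n < 0" using m n by (simp add: pos_imp_zdiv_neg_iff)
  then consider "m div int n < - 1" | "m div int n = - 1" by linarith
  then show ?thesis
  proof cases
    case 1
    then have "m \<noteq> - 1" using n div_eq_minus1[of "int n"] by auto
    then show ?thesis using 1 Y n k(1) by (simp add: coeff has_J_leading_def)
  next
    case 2
    then have "m = int k - int n" using mult_div_mod_eq[of "int n" m] k(2) by simp
    then have "k = n - 1 \<longleftrightarrow> m = - 1" using k(1) by auto
    then show ?thesis using 2 Y n k(1) by (simp add: coeff has_J_leading_def elem_mat_index)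
  qed
qed

lemma is_lax_root_0_unique:
  fixes Q :: "'a::differential_ring fls mat"
  assumes unit: "of_nat n dvd (1 :: 'a)" and n: "n \<ge> 2" and Q: "is_lax_root n (0\<^sub>m n n) Q"
  shows "Q = lax_mat n (0\<^sub>m n n)"
proof -
  let ?J = "lax_mat n (0\<^sub>m n n :: 'a mat)"
  have carrier: "Q \<in> carrier_mat n n" "?J \<in> carrier_mat n n"
    using Q by (simp_all add: is_lax_root_carrier)
  have n_pos: "n > 0" using n by simp
  have intertwines: "intertwines ?J ?J Q" by (rule is_lax_root_intertwines[OF Q zero_carrier_mat])
  have "\<partial> (row_series n Q i) + fls_X_inv * row_series n Q (cyclic_pred n i)
      = fls_X_inv * row_series n Q i" if i: "i < n" for i
  proof -
    have "row_series n (map_mat \<partial> Q) i + row_series n (?J * Q) i = row_series n (Q * ?J) i"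
      using row_series_add[OF n_pos _ mult_carrier_mat[OF carrier(2,1)] i, of "map_mat \<partial> Q"]
        carrier(1) intertwines by (simp add: intertwines_def)
    then show ?thesis
      using i n_pos carrier row_series_lax_mat_mult[OF n zero_in_V_mats carrier(1) i]
        row_series_mult_const[OF n_pos carrier i row_series_J[OF n]]
      by (simp add: row_series_derivation mult.commute)
  qed
  then have rows: "row_series n Q i = row_series n Q 0" if "i < n" for i
    using that by (rule cyclic_derivation_rows_equal[OF unit])
  have "row_series n Q 0 ^ n = fls_X_inv ^ n"
    using row_series_pow_const[OF carrier(1) rows n_pos, of n] Q n_pos
    by (simp add: is_lax_root_def row_series_smult_one fls_subst_power_X_inv
        fls_X_inv_power_conv_shift_1)
  moreover have "has_J_leading n Q" using Q by (simp add: is_lax_root_def)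
  ultimately have "row_series n Q 0 = fls_X_inv"
    by (intro fls_X_inv_unique_root[OF unit] has_J_leading_row_series_0[OF n_pos])
  then have "row_series n Q i = row_series n ?J i" if "i < n" for i
    using rows[OF that] that by (simp add: row_series_J[OF n])
  then show ?thesis by (rule row_series_eqI[OF carrier])
qed

lemma is_lax_root_characterization:
  fixes u :: "'a::differential_ring mat"
  assumes surj: "surj (\<partial> :: 'a \<Rightarrow> 'a)" and unit: "of_nat n dvd (1 :: 'a)"
    and n: "n \<ge> 2" and u: "u \<in> V_mats n"
  obtains M N where "M \<in> carrier_mat n n" "N \<in> carrier_mat n n" "M * N = 1\<^sub>m n" "N * M = 1\<^sub>m n"
    "\<And>Y. is_lax_root n u Y \<longleftrightarrow> Y = M * lax_mat n (0\<^sub>m n n) * N"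
proof -
  let ?J = "lax_mat n (0\<^sub>m n n :: 'a mat)"
  have carrier: "u \<in> carrier_mat n n" "0\<^sub>m n n \<in> carrier_mat n n"
    using V_mats_carrier[OF u] by simp_all
  obtain A B where A: "A \<in> carrier_mat n n" and B: "B \<in> carrier_mat n n"
    and inverse: "A * B = 1\<^sub>m n" "B * A = 1\<^sub>m n"
    and corner: "fixes_corner n (mat_const_term A)" "fixes_corner n (mat_const_term B)"
    and A_intertwines: "intertwines (lax_mat n u) ?J (map_mat fps_to_fls A)"
    using dressing_matrix[OF surj unit n u] by blast
  define M N where "M = map_mat fps_to_fls A" and "N = map_mat fps_to_fls B"
  have MN: "M \<in> carrier_mat n n" "N \<in> carrier_mat n n" using A B by (simp_all add: M_def N_def)
  have MN_inverse: "M * N = 1\<^sub>m n" "N * M = 1\<^sub>m n"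
    using fps_to_fls.mat_hom_mult[OF A B] fps_to_fls.mat_hom_mult[OF B A]
    by (simp_all add: M_def N_def inverse fps_to_fls.mat_hom_one)
  have "intertwines ?J (lax_mat n u) N"
    using A_intertwines carrier
    by (intro intertwines_inverse[OF _ _ MN MN_inverse]) (simp_all add: M_def)
  then have undress: "is_lax_root n (0\<^sub>m n n) (N * Y * M)" if "is_lax_root n u Y" for Y
    using is_lax_root_conj[OF B A carrier(2,1) inverse(2,1) corner(2,1) _ that]
    by (simp add: M_def N_def)
  have "Y = M * ?J * N" if Y: "is_lax_root n u Y" for Y
  proof -
    have "N * Y * M = ?J" by (rule is_lax_root_0_unique[OF unit n undress[OF Y]])
    moreover have "(M * N) * Y * (M * N) = M * (N * Y * M) * N"
      using MN is_lax_root_carrier[OF Y] by (simp only: square_mat_simps[where n=n])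
    ultimately show ?thesis using is_lax_root_carrier[OF Y] by (simp add: MN_inverse)
  qed
  moreover have "is_lax_root n u (M * ?J * N)"
    using is_lax_root_conj[OF A B carrier inverse corner A_intertwines is_lax_root_J[OF n]]
    by (simp add: M_def N_def)
  ultimately show ?thesis using that[OF MN MN_inverse] by blast
qed

lemma ex1_lax_root:
  fixes u :: "'a::differential_ring mat"
  assumes "surj (\<partial> :: 'a \<Rightarrow> 'a)" "of_nat n dvd (1 :: 'a)" "n \<ge> 2" "u \<in> V_mats n"
  shows "\<exists>!Y. is_lax_root n u Y"
  using is_lax_root_characterization[OF assms] by metis

lemma mat_trace_lax_root_pow:
  fixes u :: "'a::differential_ring mat"
  assumes "surj (\<partial> :: 'a \<Rightarrow> 'a)" "of_nat n dvd (1 :: 'a)" "n \<ge> 2" "u \<in> V_mats n"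
    and Y: "is_lax_root n u Y" and j: "\<not> n dvd j"
  shows "mat_trace (Y ^\<^sub>m j) = 0"
proof -
  let ?J = "lax_mat n (0\<^sub>m n n :: 'a mat)"
  obtain M N where "M \<in> carrier_mat n n" "N \<in> carrier_mat n n" "M * N = 1\<^sub>m n" "N * M = 1\<^sub>m n"
    and "Y = M * ?J * N"
    using is_lax_root_characterization[OF assms(1-4)] Y by metis
  then have "similar_mat_wit Y ?J M N"
    using is_lax_root_carrier[OF Y] by (intro similar_mat_witI) auto
  then have "mat_trace (Y ^\<^sub>m j) = mat_trace (?J ^\<^sub>m j)"
    by (intro mat_trace_similar similar_mat_wit_pow)
  then show ?thesis using mat_trace_J_pow[OF \<open>n \<ge> 2\<close> j] by simp
qed

abbreviation mat_coeff :: "int \<Rightarrow> 'a::zero fls mat \<Rightarrow> 'a mat" where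
  "mat_coeff m \<equiv> map_mat (\<lambda>f. fls_nth f m)"

lemma covariant_deriv_coeff_0_below:
  fixes u :: "'a::differential_ring mat"
  assumes n: "n \<ge> 2" and u: "u \<in> V_mats n" and Y: "Y \<in> carrier_mat n n"
    and intertwines: "intertwines (lax_mat n u) (lax_mat n u) Y" and ik: "k < i" "i < n"
  shows "covariant_deriv (b_mat n + u) (mat_coeff 0 Y) $$ (i, k) = 0"
proof -
  have k: "Suc k < n" "k < n" using ik by auto
  note lax_V = spectral_V_in_V_mats[OF n u]
  have lax: "lax_mat n u \<in> carrier_mat n n" using V_mats_carrier[OF u] by simp
  have entry: "spectral_V n u $$ (i, n - 1) = fls_const (u $$ (i, n - 1))"
    using ik V_mats_carrier[OF u] by (simp add: spectral_V_def elem_mat_index)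
  have "covariant_deriv (lax_mat n u) Y $$ (i, k) = 0"
    using covariant_deriv_eq_0_iff[OF lax Y] intertwines ik k by simp
  then have "\<partial> (Y $$ (i, k)) + (Y $$ (i - 1, k) + fls_const (u $$ (i, n - 1)) * Y $$ (n - 1, k))
      - Y $$ (i, Suc k) = 0"
    using ik
    unfolding lax_mat_def covariant_deriv_V_mats_index[OF lax_V Y ik(2) k(1)] entry by simp
  from arg_cong[OF this, of "\<lambda>f. fls_nth f 0"] show ?thesis
    using ik k Y by (simp add: covariant_deriv_V_mats_index[OF u _ ik(2) k(1)])
qed


section \<open>The strictly upper triangular correction\<close>

definition strictly_upper_mats :: "nat \<Rightarrow> 'a::zero mat set" where
  "strictly_upper_mats n = {A \<in> carrier_mat n n. \<forall>i<n. \<forall>k\<le>i. A $$ (i, k) = 0}"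

primrec covariant_column :: "nat \<Rightarrow> 'a::differential_ring mat \<Rightarrow> (nat \<Rightarrow> 'a) \<Rightarrow> nat \<Rightarrow> nat \<Rightarrow> 'a" where
  "covariant_column n v c 0 = c"
| "covariant_column n v c (Suc k) = (\<lambda>i. \<partial> (covariant_column n v c k i)
     + ((if i = 0 then 0 else covariant_column n v c k (i - 1))
        + v $$ (i, n - 1) * covariant_column n v c k (n - 1)))"

lemma exists_covariant_columns:
  fixes v :: "'a::differential_ring mat"
  assumes v: "v \<in> V_mats n" and n: "n > 0"
  obtains Z where "Z \<in> carrier_mat n n" "\<And>i. i < n \<Longrightarrow> Z $$ (i, 0) = c i"
    "\<And>i k. i < n \<Longrightarrow> Suc k < n \<Longrightarrow> covariant_deriv (b_mat n + v) Z $$ (i, k) = 0"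
proof -
  define Z where "Z = mat n n (\<lambda>(i, k). covariant_column n v c k i)"
  have Z: "Z \<in> carrier_mat n n" by (simp add: Z_def)
  moreover have index: "Z $$ (i, k) = covariant_column n v c k i" if "i < n" "k < n" for i k
    using that by (simp add: Z_def)
  then have "Z $$ (i, 0) = c i" if "i < n" for i using that n by simp
  moreover have "covariant_deriv (b_mat n + v) Z $$ (i, k) = 0" if "i < n" "Suc k < n" for i k
    using that n by (simp add: covariant_deriv_V_mats_index[OF v Z that] index)
  ultimately show ?thesis using that by blast
qed

lemma covariant_columns_determined:
  fixes v :: "'a::differential_ring mat"
  assumes v: "v \<in> V_mats n" and carrier: "A \<in> carrier_mat n n" "Z \<in> carrier_mat n n"
    and first: "\<And>i. i < n \<Longrightarrow> A $$ (i, 0) = Z $$ (i, 0)"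
    and vanish: "\<And>i k. R i (Suc k) \<Longrightarrow> i < n \<Longrightarrow> Suc k < n \<Longrightarrow>
      covariant_deriv (b_mat n + v) A $$ (i, k) = 0 \<and> covariant_deriv (b_mat n + v) Z $$ (i, k) = 0"
    and closed: "\<And>i k. R i (Suc k) \<Longrightarrow> i < n \<Longrightarrow> R i k \<and> (i > 0 \<longrightarrow> R (i - 1) k) \<and> R (n - 1) k"
  shows "R i k \<Longrightarrow> i < n \<Longrightarrow> k < n \<Longrightarrow> A $$ (i, k) = Z $$ (i, k)"
proof (induction k arbitrary: i)
  case 0
  then show ?case using first by simp
next
  case (Suc k)
  have "A $$ (i, k) = Z $$ (i, k)" "i > 0 \<Longrightarrow> A $$ (i - 1, k) = Z $$ (i - 1, k)"
    "A $$ (n - 1, k) = Z $$ (n - 1, k)"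
    using Suc.prems closed[OF Suc.prems(1,2)] by (auto intro!: Suc.IH)
  then show ?case
    using vanish[OF Suc.prems] covariant_deriv_V_mats_index[OF v _ Suc.prems(2,3)] carrier
    by (cases "i = 0") auto
qed

lemma covariant_deriv_in_V_mats:
  assumes v: "v \<in> V_mats n" and Z: "Z \<in> carrier_mat n n" and n: "n > 0"
    and left: "\<And>i k. i < n \<Longrightarrow> Suc k < n \<Longrightarrow> covariant_deriv (b_mat n + v) Z $$ (i, k) = 0"
    and trace: "mat_trace Z = 0"
  shows "covariant_deriv (b_mat n + v) Z \<in> V_mats n"
proof -
  let ?D = "covariant_deriv (b_mat n + v) Z"
  have b_plus_v: "b_mat n + v \<in> carrier_mat n n" using V_mats_carrier[OF v] by simp
  have D: "?D \<in> carrier_mat n n" by (rule covariant_deriv_carrier[OF b_plus_v Z])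
  obtain m where m: "n = Suc m" using n by (cases n) auto
  have "mat_trace ?D = (\<Sum>i<m. ?D $$ (i, i)) + ?D $$ (m, m)"
    using D by (simp add: mat_trace_def m)
  also have "(\<Sum>i<m. ?D $$ (i, i)) = 0" using left by (simp add: m)
  finally have "?D $$ (m, m) = 0" using mat_trace_covariant_deriv[OF b_plus_v Z] trace by simp
  then show ?thesis using D left by (intro V_matsI) (simp_all add: m)
qed

lemma ex1_strictly_upper_correction:
  fixes v :: "'a::differential_ring mat"
  assumes v: "v \<in> V_mats n" and n: "n > 0" and A: "A \<in> carrier_mat n n"
    and below: "\<And>i k. k < i \<Longrightarrow> i < n \<Longrightarrow> covariant_deriv (b_mat n + v) A $$ (i, k) = 0"
    and trace: "mat_trace A = 0"
  shows "\<exists>!\<zeta>. \<zeta> \<in> strictly_upper_mats n \<and> covariant_deriv (b_mat n + v) (A - \<zeta>) \<in> V_mats n"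
proof -
  obtain Z where Z: "Z \<in> carrier_mat n n" and first: "\<And>i. i < n \<Longrightarrow> Z $$ (i, 0) = A $$ (i, 0)"
    and left: "\<And>i k. i < n \<Longrightarrow> Suc k < n \<Longrightarrow> covariant_deriv (b_mat n + v) Z $$ (i, k) = 0"
    using exists_covariant_columns[OF v n, of "\<lambda>i. A $$ (i, 0)"] by blast
  have lower: "A $$ (i, k) = Z $$ (i, k)" if "k \<le> i" "i < n" for i k
  proof (rule covariant_columns_determined[OF v A Z, where R = "\<lambda>i k. k \<le> i"])
    show "covariant_deriv (b_mat n + v) A $$ (i, k) = 0
        \<and> covariant_deriv (b_mat n + v) Z $$ (i, k) = 0"
      if "Suc k \<le> i" "i < n" "Suc k < n" for i k
      using that below left by simp
  qed (use that first in auto)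
  then have "mat_trace Z = 0" using trace A Z by (simp add: mat_trace_def)
  then have "covariant_deriv (b_mat n + v) Z \<in> V_mats n"
    using left by (intro covariant_deriv_in_V_mats[OF v Z n])
  moreover have "A - (A - Z) = Z" using A Z by (intro eq_matI) auto
  moreover have "A - Z \<in> strictly_upper_mats n"
    using A Z lower by (auto simp: strictly_upper_mats_def)
  moreover have "\<zeta> = A - Z"
    if upper: "\<zeta> \<in> strictly_upper_mats n"
      and in_V: "covariant_deriv (b_mat n + v) (A - \<zeta>) \<in> V_mats n" for \<zeta>
  proof -
    have \<zeta>: "\<zeta> \<in> carrier_mat n n" and zeta_col_0: "\<And>i. i < n \<Longrightarrow> \<zeta> $$ (i, 0) = 0"
      using upper by (auto simp: strictly_upper_mats_def)
    have "(A - \<zeta>) $$ (i, k) = Z $$ (i, k)" if "i < n" "k < n" for i k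
      by (rule covariant_columns_determined[OF v minus_carrier_mat[OF \<zeta>] Z, where R = "\<lambda>i k. True"])
        (use that first left \<zeta> zeta_col_0 V_mats_index_left[OF in_V] A n in auto)
    then have "A - \<zeta> = Z" using A \<zeta> Z by (intro eq_matI) auto
    moreover have "A - (A - \<zeta>) = \<zeta>" using A \<zeta> by (intro eq_matI) auto
    ultimately show ?thesis by simp
  qed
  ultimately show ?thesis by (metis (no_types, lifting))
qed


section \<open>Moving frames\<close>

definition wronskian_mat :: "nat \<Rightarrow> (nat \<Rightarrow> 'a::differential_ring) \<Rightarrow> 'a mat" where
  "wronskian_mat n c = mat n n (\<lambda>(i, k). (\<partial> ^^ k) (c i))"

lemma wronskian_mat_carrier [simp]: "wronskian_mat n c \<in> carrier_mat n n"
  by (simp add: wronskian_mat_def)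

lemma dim_wronskian_mat [simp]:
  "dim_row (wronskian_mat n c) = n" "dim_col (wronskian_mat n c) = n"
  by (simp_all add: wronskian_mat_def)

lemma wronskian_mat_index: "i < n \<Longrightarrow> k < n \<Longrightarrow> wronskian_mat n c $$ (i, k) = (\<partial> ^^ k) (c i)"
  by (simp add: wronskian_mat_def)

lemma frame_equation:
  fixes c :: "nat \<Rightarrow> 'a::differential_ring"
  assumes n: "n > 0" and det: "det (wronskian_mat n c) = 1"
  obtains u where "u \<in> V_mats n"
    "map_mat \<partial> (wronskian_mat n c) = wronskian_mat n c * (b_mat n + u)"
proof -
  let ?W = "wronskian_mat n c"
  define B where "B = adj_mat ?W * map_mat \<partial> ?W"
  have adj: "adj_mat ?W \<in> carrier_mat n n" "?W * adj_mat ?W = 1\<^sub>m n" "adj_mat ?W * ?W = 1\<^sub>m n"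
    using adj_mat[OF wronskian_mat_carrier, of n c] det by auto
  have deriv_W: "map_mat \<partial> ?W \<in> carrier_mat n n" by simp
  have B: "B \<in> carrier_mat n n" unfolding B_def by (rule mult_carrier_mat[OF adj(1) deriv_W])
  have WB: "?W * B = map_mat \<partial> ?W"
    unfolding B_def
    by (simp add: adj(2) left_mult_one_mat[OF deriv_W]
        flip: assoc_mult_mat[OF wronskian_mat_carrier adj(1) deriv_W])
  have B_left: "B $$ (i, k) = b_mat n $$ (i, k)" if i: "i < n" and k: "Suc k < n" for i k
  proof -
    have "B $$ (i, k) = (adj_mat ?W * ?W) $$ (i, Suc k)"
      unfolding B_def index_mult_mat_sum[OF adj(1) deriv_W i Suc_lessD[OF k]]
        index_mult_mat_sum[OF adj(1) wronskian_mat_carrier i k]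
      using k by (intro sum.cong) (simp_all add: wronskian_mat_index)
    then show ?thesis using i k by (simp add: adj b_mat_index)
  qed
  have "mat_trace B = 0"
    using derivation_det_mult[OF wronskian_mat_carrier B WB[symmetric]] det by simp
  moreover obtain m where m: "n = Suc m" using n by (cases n) auto
  ultimately have "(\<Sum>i<m. B $$ (i, i)) + B $$ (m, m) = 0" using B by (simp add: mat_trace_def)
  moreover have "(\<Sum>i<m. B $$ (i, i)) = 0"
    by (intro sum.neutral) (simp add: B_left m b_mat_index)
  ultimately have "B - b_mat n \<in> V_mats n"
    using B B_left by (intro V_matsI minus_carrier_mat) (simp_all add: m b_mat_index)
  moreover have "b_mat n + (B - b_mat n) = B"
    using B by (intro eq_matI) auto
  ultimately show ?thesis using that WB by metis
qed

lemma wronskian_mat_top_derivative: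
  fixes c :: "nat \<Rightarrow> 'a::differential_ring"
  assumes n: "n > 0" and u: "u \<in> V_mats n" and i: "i < n"
    and frame: "map_mat \<partial> (wronskian_mat n c) = wronskian_mat n c * (b_mat n + u)"
  shows "(\<partial> ^^ n) (c i) = (wronskian_mat n c * u) $$ (i, n - 1)"
proof -
  let ?W = "wronskian_mat n c"
  have last: "n - 1 < n" using n by simp
  note u_carrier = V_mats_carrier[OF u]
  obtain m where m: "n = Suc m" using n by (cases n) auto
  have "(\<partial> ^^ n) (c i) = map_mat \<partial> ?W $$ (i, n - 1)"
    using i by (simp add: m wronskian_mat_index)
  also have "\<dots> = (?W * u) $$ (i, n - 1)"
    unfolding frame
      index_mult_mat_sum[OF wronskian_mat_carrier add_carrier_mat[OF u_carrier] i last]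
      index_mult_mat_sum[OF wronskian_mat_carrier u_carrier i last]
    using u_carrier last by (intro sum.cong) (auto simp: b_mat_index)
  finally show ?thesis .
qed

lemma derivation_frame_mult_index:
  fixes G :: "'a::differential_ring mat"
  assumes carrier: "G \<in> carrier_mat n n" "Z \<in> carrier_mat n n" and u: "u \<in> V_mats n"
    and frame: "map_mat \<partial> G = G * (b_mat n + u)"
    and Z: "covariant_deriv (b_mat n + u) Z \<in> V_mats n"
    and i: "i < n" and k: "Suc k < n"
  shows "\<partial> ((G * Z) $$ (i, k)) = (G * Z) $$ (i, Suc k)"
proof -
  note k_less = Suc_lessD[OF k]
  have b_plus_u: "b_mat n + u \<in> carrier_mat n n" using V_mats_carrier[OF u] by simp
  have deriv_Z: "map_mat \<partial> Z \<in> carrier_mat n n" using carrier by simp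
  let ?S = "(b_mat n + u) * Z + map_mat \<partial> Z"
  have "\<partial> ((G * Z) $$ (i, k)) = map_mat \<partial> (G * Z) $$ (i, k)"
    using carrier i k_less by (simp del: index_mult_mat(1))
  also have "map_mat \<partial> (G * Z) = G * ?S"
    unfolding map_mat_derivation_mult[OF carrier] frame
    by (simp only: square_mat_simps[where n=n] carrier b_plus_u deriv_Z)
  also have "(G * ?S) $$ (i, k) = (\<Sum>l<n. G $$ (i, l) * ?S $$ (l, k))"
    using b_plus_u carrier deriv_Z by (intro index_mult_mat_sum[OF carrier(1) _ i k_less]) simp
  also have "\<dots> = (\<Sum>l<n. G $$ (i, l) * Z $$ (l, Suc k))"
  proof (rule sum.cong)
    fix l assume "l \<in> {..<n}"
    then have l: "l < n" by simp
    have "covariant_deriv (b_mat n + u) Z $$ (l, k) = 0" by (rule V_mats_index_left[OF Z l k])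
    then have "((b_mat n + u) * Z) $$ (l, k) + \<partial> (Z $$ (l, k)) = Z $$ (l, Suc k)"
      unfolding covariant_deriv_index[OF b_plus_u carrier(2) l k_less]
        mult_b_mat_add_V_mats_index[OF u carrier(2) l k]
      by (simp add: add.commute)
    then show "G $$ (i, l) * ?S $$ (l, k) = G $$ (i, l) * Z $$ (l, Suc k)"
      using l k carrier(2) by (simp del: index_mult_mat(1))
  qed simp
  also have "\<dots> = (G * Z) $$ (i, Suc k)"
    by (rule index_mult_mat_sum[OF carrier i k, symmetric])
  finally show ?thesis .
qed

lemma frame_mult_eq_wronskian_mat:
  fixes G :: "'a::differential_ring mat"
  assumes carrier: "G \<in> carrier_mat n n" "Z \<in> carrier_mat n n" and u: "u \<in> V_mats n"
    and frame: "map_mat \<partial> G = G * (b_mat n + u)"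
    and Z: "covariant_deriv (b_mat n + u) Z \<in> V_mats n"
  shows "G * Z = wronskian_mat n (\<lambda>i. (G * Z) $$ (i, 0))"
proof -
  have "(\<partial> ^^ k) ((G * Z) $$ (i, 0)) = (G * Z) $$ (i, k)" if "i < n" "k < n" for i k
    using that(2)
  proof (induction k)
    case (Suc k)
    then show ?case using derivation_frame_mult_index[OF assms that(1), of k] by simp
  qed simp
  then show ?thesis
    using mult_carrier_mat[OF carrier]
    by (intro eq_matI) (auto simp: wronskian_mat_index simp del: index_mult_mat(1))
qed


section \<open>The differential ring of smooth functions\<close>

lemma smooth_fun_iff_deriv:
  "smooth_fun f \<longleftrightarrow> (\<forall>x. f field_differentiable at x) \<and> smooth_fun (deriv f)"
proof -
  have "(\<forall>k. P k) \<longleftrightarrow> P 0 \<and> (\<forall>k. P (Suc k))" for P :: "nat \<Rightarrow> bool"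
    by (metis not0_implies_Suc)
  from this[of "\<lambda>k. \<forall>x. (deriv ^^ k) f field_differentiable at x"] show ?thesis
    unfolding smooth_fun_def by (simp only: funpow_0 funpow_Suc_right o_apply)
qed

lemma smooth_fun_deriv: "smooth_fun f \<Longrightarrow> smooth_fun (deriv f)"
  using smooth_fun_iff_deriv by blast

lemma smooth_fun_differentiable: "smooth_fun f \<Longrightarrow> f field_differentiable at x"
  using smooth_fun_iff_deriv by blast

lemma smooth_fun_coinduct:
  assumes "S f"
    and "\<And>f x. S f \<Longrightarrow> f field_differentiable at x"
    and "\<And>f. S f \<Longrightarrow> S (deriv f)"
  shows "smooth_fun f"
proof -
  have "S ((deriv ^^ k) f)" for k
    by (induction k) (auto simp: assms)
  then show ?thesis using assms(2) by (auto simp: smooth_fun_def)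
qed

inductive smooth_generated :: "(real \<Rightarrow> real) \<Rightarrow> bool" where
  smooth: "smooth_fun f \<Longrightarrow> smooth_generated f"
| add: "smooth_generated f \<Longrightarrow> smooth_generated g \<Longrightarrow> smooth_generated (\<lambda>x. f x + g x)"
| mult: "smooth_generated f \<Longrightarrow> smooth_generated g \<Longrightarrow> smooth_generated (\<lambda>x. f x * g x)"

lemma smooth_generated_differentiable: "smooth_generated f \<Longrightarrow> f field_differentiable at x"
  by (induction rule: smooth_generated.induct)
     (auto intro: smooth_fun_differentiable field_differentiable_add field_differentiable_mult)

lemma smooth_generated_imp_smooth_fun:
  assumes "smooth_generated f"
  shows "smooth_fun f"
  using assms smooth_generated_differentiable
proof (rule smooth_fun_coinduct[of smooth_generated])
  show "smooth_generated (deriv f)" if "smooth_generated f" for f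
    using that
  proof (induction rule: smooth_generated.induct)
    case (smooth f)
    then show ?case by (intro smooth_generated.smooth smooth_fun_deriv)
  next
    case (add f g)
    have "deriv (\<lambda>x. f x + g x) = (\<lambda>x. deriv f x + deriv g x)"
      by (rule ext) (simp add: add smooth_generated_differentiable)
    then show ?case using add by (simp add: smooth_generated.add)
  next
    case (mult f g)
    have "deriv (\<lambda>x. f x * g x) = (\<lambda>x. f x * deriv g x + deriv f x * g x)"
      by (rule ext) (simp add: mult smooth_generated_differentiable)
    then show ?case using mult by (simp add: smooth_generated.add smooth_generated.mult)
  qed
qed

lemma smooth_fun_add: "smooth_fun f \<Longrightarrow> smooth_fun g \<Longrightarrow> smooth_fun (\<lambda>x. f x + g x)"
  by (rule smooth_generated_imp_smooth_fun) (auto intro: smooth_generated.intros)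

lemma smooth_fun_mult: "smooth_fun f \<Longrightarrow> smooth_fun g \<Longrightarrow> smooth_fun (\<lambda>x. f x * g x)"
  by (rule smooth_generated_imp_smooth_fun) (auto intro: smooth_generated.intros)

lemma smooth_fun_const: "smooth_fun (\<lambda>x. c)"
proof (rule smooth_fun_coinduct[of "\<lambda>f. \<exists>c. f = (\<lambda>x. c)"])
  show "\<exists>c. deriv f = (\<lambda>x. c)" if "\<exists>c. f = (\<lambda>x. c)" for f :: "real \<Rightarrow> real"
    using that by auto
qed auto

lemma smooth_fun_minus: "smooth_fun f \<Longrightarrow> smooth_fun (\<lambda>x. - f x)"
  using smooth_fun_mult[OF smooth_fun_const[of "-1"]] by simp

lemma smooth_fun_antiderivative:
  assumes "smooth_fun f"
  obtains F where "smooth_fun F" "deriv F = f"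
proof -
  have "isCont f x" for x
    using assms by (intro field_differentiable_imp_continuous_at smooth_fun_differentiable)
  then obtain F where "\<And>x. (F has_vector_derivative f x) (at x)"
    using einterval_antiderivative[of "- \<infinity>" "\<infinity>" f] by auto
  then have F: "(F has_field_derivative f x) (at x)" for x
    by (simp add: has_real_derivative_iff_has_vector_derivative)
  then have "deriv F = f" by (auto intro: DERIV_imp_deriv)
  moreover have "smooth_fun F"
    unfolding smooth_fun_iff_deriv[of F]
    using F assms \<open>deriv F = f\<close> by (auto simp: field_differentiable_def)
  ultimately show ?thesis using that by blast
qed

typedef smooth_real = "{f. smooth_fun f}" morphisms smooth_eval Smooth
  using smooth_fun_const by blast

setup_lifting type_definition_smooth_real

instantiation smooth_real :: differential_ring
begin

lift_definition zero_smooth_real :: smooth_real is "\<lambda>x. 0" by (rule smooth_fun_const)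
lift_definition one_smooth_real :: smooth_real is "\<lambda>x. 1" by (rule smooth_fun_const)
lift_definition plus_smooth_real :: "smooth_real \<Rightarrow> smooth_real \<Rightarrow> smooth_real"
  is "\<lambda>f g x. f x + g x" by (rule smooth_fun_add)
lift_definition times_smooth_real :: "smooth_real \<Rightarrow> smooth_real \<Rightarrow> smooth_real"
  is "\<lambda>f g x. f x * g x" by (rule smooth_fun_mult)
lift_definition uminus_smooth_real :: "smooth_real \<Rightarrow> smooth_real"
  is "\<lambda>f x. - f x" by (rule smooth_fun_minus)
lift_definition minus_smooth_real :: "smooth_real \<Rightarrow> smooth_real \<Rightarrow> smooth_real"
  is "\<lambda>f g x. f x + - g x" by (intro smooth_fun_add smooth_fun_minus)
lift_definition derivation_smooth_real :: "smooth_real \<Rightarrow> smooth_real"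
  is deriv by (rule smooth_fun_deriv)

instance
proof
  fix f g h :: smooth_real
  show "f + g + h = f + (g + h)" "f + g = g + f" "0 + f = f" "- f + f = 0" "f - g = f + - g"
    "f * g * h = f * (g * h)" "f * g = g * f" "1 * f = f" "(f + g) * h = f * h + g * h"
    "(0 :: smooth_real) \<noteq> 1"
    by (transfer; auto simp: algebra_simps fun_eq_iff)+
  show "\<partial> (f + g) = \<partial> f + \<partial> g" "\<partial> (f * g) = \<partial> f * g + f * \<partial> g"
    by (transfer; auto simp: smooth_fun_differentiable)+
qed

end

lemma smooth_eval_derivation: "smooth_eval (\<partial> f) = deriv (smooth_eval f)"
  by transfer simp

lemma smooth_eval_funpow_derivation: "smooth_eval ((\<partial> ^^ k) f) = (deriv ^^ k) (smooth_eval f)"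
  by (induction k) (simp_all add: smooth_eval_derivation)

interpretation smooth_eval: comm_ring_hom "\<lambda>f. smooth_eval f x" for x
  by unfold_locales (transfer; simp)+

interpretation fls_eval: comm_ring_hom "fls_map (\<lambda>f. smooth_eval f x)" for x
  by (rule comm_ring_hom_fls_map) unfold_locales

lemma smooth_eqI: "(\<And>x. smooth_eval f x = smooth_eval g x) \<Longrightarrow> f = g"
  by transfer auto

lemma smooth_fun_smooth_eval [simp]: "smooth_fun (smooth_eval f)"
  by transfer

lemma smooth_eval_Smooth: "smooth_fun f \<Longrightarrow> smooth_eval (Smooth f) = f"
  by (simp add: Smooth_inverse)

lemma surj_derivation_smooth_real: "surj (\<partial> :: smooth_real \<Rightarrow> smooth_real)"
  unfolding surj_def
proof
  fix f
  obtain F where "smooth_fun F" "deriv F = smooth_eval f"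
    using smooth_fun_antiderivative[OF smooth_fun_smooth_eval] by blast
  then have "f = \<partial> (Smooth F)"
    by (intro smooth_eqI) (simp add: smooth_eval_derivation smooth_eval_Smooth)
  then show "\<exists>F. f = \<partial> F" ..
qed

lemma smooth_eval_of_nat [simp]: "smooth_eval (of_nat n) x = real n"
  by (induction n) (simp_all add: smooth_eval.hom_add)

lemma of_nat_smooth_real_dvd_1:
  assumes "n > 0"
  shows "of_nat n dvd (1 :: smooth_real)"
proof
  show "1 = of_nat n * Smooth (\<lambda>x. 1 / real n)"
    using assms by (intro smooth_eqI)
      (simp add: smooth_eval.hom_mult smooth_eval_Smooth smooth_fun_const)
qed


section \<open>Evaluation of matrices\<close>

definition mat_eval :: "smooth_real mat \<Rightarrow> real \<Rightarrow> real mat" where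
  "mat_eval A x = map_mat (\<lambda>f. smooth_eval f x) A"

definition fls_mat_eval :: "smooth_real fls mat \<Rightarrow> real \<Rightarrow> real fls mat" where
  "fls_mat_eval A x = map_mat (fls_map (\<lambda>f. smooth_eval f x)) A"

lemma mat_eval_carrier [simp]: "mat_eval A x \<in> carrier_mat m n \<longleftrightarrow> A \<in> carrier_mat m n"
  by (simp add: mat_eval_def)

lemma mat_eval_index:
  "A \<in> carrier_mat m n \<Longrightarrow> i < m \<Longrightarrow> k < n \<Longrightarrow>
    mat_eval A x $$ (i, k) = smooth_eval (A $$ (i, k)) x"
  by (simp add: mat_eval_def)

lemma mat_eval_inject:
  assumes "A \<in> carrier_mat n n" "B \<in> carrier_mat n n"
  shows "(\<forall>x. mat_eval A x = mat_eval B x) \<longleftrightarrow> A = B"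
proof
  assume eq: "\<forall>x. mat_eval A x = mat_eval B x"
  show "A = B"
  proof (rule eq_matI)
    fix i k assume "i < dim_row B" "k < dim_col B"
    then have ik: "i < n" "k < n" using assms by auto
    show "A $$ (i, k) = B $$ (i, k)"
      using eq mat_eval_index[OF assms(1) ik] mat_eval_index[OF assms(2) ik]
      by (intro smooth_eqI) metis
  qed (use assms in auto)
qed simp

lemma smooth_mat_iff: "smooth_mat n A \<longleftrightarrow> (\<exists>S\<in>carrier_mat n n. A = mat_eval S)"
proof
  assume A: "smooth_mat n A"
  define S where "S = mat n n (\<lambda>(i, k). Smooth (\<lambda>x. A x $$ (i, k)))"
  have "A = mat_eval S"
  proof
    fix x
    have "A x \<in> carrier_mat n n" using A by (simp add: smooth_mat_def)
    then show "A x = mat_eval S x"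
      using A by (intro eq_matI) (auto simp: S_def smooth_mat_def mat_eval_def smooth_eval_Smooth)
  qed
  moreover have "S \<in> carrier_mat n n" by (simp add: S_def)
  ultimately show "\<exists>S\<in>carrier_mat n n. A = mat_eval S" by blast
next
  assume "\<exists>S\<in>carrier_mat n n. A = mat_eval S"
  then show "smooth_mat n A" by (auto simp: smooth_mat_def mat_eval_index)
qed

lemma mat_deriv_mat_eval:
  assumes "A \<in> carrier_mat n n"
  shows "mat_deriv n (mat_eval A) x = mat_eval (map_mat \<partial> A) x"
proof (rule eq_matI)
  fix i k assume "i < dim_row (mat_eval (map_mat \<partial> A) x)" "k < dim_col (mat_eval (map_mat \<partial> A) x)"
  then have ik: "i < n" "k < n" using assms by (auto simp: mat_eval_def)
  have "(\<lambda>y. mat_eval A y $$ (i, k)) = smooth_eval (A $$ (i, k))"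
    using ik assms by (auto simp: mat_eval_index)
  then show "mat_deriv n (mat_eval A) x $$ (i, k) = mat_eval (map_mat \<partial> A) x $$ (i, k)"
    using ik assms by (simp add: mat_deriv_def mat_eval_def smooth_eval_derivation)
qed (use assms in \<open>auto simp: mat_deriv_def mat_eval_def\<close>)

lemma mat_eval_mult:
  "A \<in> carrier_mat m n \<Longrightarrow> B \<in> carrier_mat n k \<Longrightarrow> mat_eval (A * B) x = mat_eval A x * mat_eval B x"
  unfolding mat_eval_def by (rule smooth_eval.mat_hom_mult)

lemma mat_eval_diff:
  "A \<in> carrier_mat m n \<Longrightarrow> B \<in> carrier_mat m n \<Longrightarrow> mat_eval (A - B) x = mat_eval A x - mat_eval B x"
  unfolding mat_eval_def by (intro eq_matI) (auto simp: smooth_eval.hom_minus)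

lemma det_mat_eval: "det (mat_eval A x) = smooth_eval (det A) x"
  by (simp add: mat_eval_def)

lemma map_mat_commutator:
  assumes "comm_ring_hom h" "A \<in> carrier_mat n n" "B \<in> carrier_mat n n"
  shows "map_mat h (commutator A B) = commutator (map_mat h A) (map_mat h B)"
proof -
  interpret comm_ring_hom h by (fact assms(1))
  have "map_mat h (A * B - B * A) = map_mat h (A * B) - map_mat h (B * A)"
    using assms(2,3) by (intro eq_matI) (auto simp: hom_minus simp del: index_mult_mat(1))
  then show ?thesis
    unfolding commutator_def using mat_hom_mult[OF assms(2,3)] mat_hom_mult[OF assms(3,2)] by simp
qed

lemma mat_trace_mat_eval:
  "A \<in> carrier_mat n n \<Longrightarrow> mat_trace (mat_eval A x) = smooth_eval (mat_trace A) x"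
  by (simp add: mat_trace_def mat_eval_index smooth_eval.hom_sum)

lemma mat_eval_covariant_deriv:
  assumes A: "A \<in> carrier_mat n n" and Z: "Z \<in> carrier_mat n n"
  shows "mat_eval (covariant_deriv A Z) x
    = mat_deriv n (mat_eval Z) x + commutator (mat_eval A x) (mat_eval Z x)"
proof -
  have "mat_eval (covariant_deriv A Z) x = mat_eval (map_mat \<partial> Z) x + mat_eval (commutator A Z) x"
    using A Z unfolding mat_eval_def covariant_deriv_def commutator_def
    by (intro eq_matI) (auto simp: smooth_eval.hom_add simp del: index_mult_mat(1))
  then show ?thesis
    using map_mat_commutator[OF smooth_eval.comm_ring_hom_axioms A Z, of x] mat_deriv_mat_eval[OF Z]
    by (simp add: mat_eval_def)
qed

lemma mat_eval_b_mat_add: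
  assumes "A \<in> carrier_mat n n"
  shows "mat_eval (b_mat n + A) x = b_mat n + mat_eval A x"
  using assms unfolding mat_eval_def
  by (intro eq_matI) (auto simp: smooth_eval.hom_add b_mat_def)

lemma V_space_eq_V_mats: "V_space n = V_mats n"
  by (simp add: V_space_def V_mats_def)

lemma mat_eval_in_V_mats_iff:
  assumes "A \<in> carrier_mat n n"
  shows "(\<forall>x. mat_eval A x \<in> V_mats n) \<longleftrightarrow> A \<in> V_mats n"
proof -
  have nonzero: "A $$ (i, k) \<noteq> 0 \<longleftrightarrow> (\<exists>x. mat_eval A x $$ (i, k) \<noteq> 0)" if "i < n" "k < n" for i k
    using that assms smooth_eqI[of "A $$ (i, k)" 0] by (auto simp: mat_eval_index)
  have "(\<forall>x. mat_eval A x \<in> V_mats n) \<longleftrightarrow>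
      (\<forall>i<n. \<forall>k<n. (\<exists>x. mat_eval A x $$ (i, k) \<noteq> 0) \<longrightarrow> i < n - 1 \<and> k = n - 1)"
    using assms unfolding V_mats_def mem_Collect_eq mat_eval_carrier by blast
  also have "\<dots> \<longleftrightarrow> A \<in> V_mats n"
    using assms by (simp add: V_mats_def flip: nonzero)
  finally show ?thesis .
qed

lemma mat_eval_strictly_upper_iff:
  assumes "A \<in> carrier_mat n n"
  shows "(\<forall>x. strictly_upper n (mat_eval A x)) \<longleftrightarrow> A \<in> strictly_upper_mats n"
proof -
  have zero: "A $$ (i, k) = 0 \<longleftrightarrow> (\<forall>x. mat_eval A x $$ (i, k) = 0)" if "i < n" "k < n" for i k
    using that assms smooth_eqI[of "A $$ (i, k)" 0] by (auto simp: mat_eval_index)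
  then show ?thesis using assms
    unfolding strictly_upper_def strictly_upper_mats_def by (auto dest: le_less_trans)
qed


section \<open>The matrix \<open>Z\<^sub>j\<^sub>,\<^sub>0(u)\<close> for smooth \<open>u\<close>\<close>

lemma fls_mat_eval_carrier [simp]: "fls_mat_eval A x \<in> carrier_mat m n \<longleftrightarrow> A \<in> carrier_mat m n"
  by (simp add: fls_mat_eval_def)

lemma lam_coeff_index:
  "A \<in> carrier_mat m n \<Longrightarrow> i < m \<Longrightarrow> k < n \<Longrightarrow> lam_coeff p A $$ (i, k) = fls_nth (A $$ (i, k)) (- p)"
  by (simp add: lam_coeff_def)

lemma lam_coeff_fls_mat_eval: "lam_coeff p (fls_mat_eval A x) = mat_eval (mat_coeff (- p) A) x"
  by (rule eq_matI) (simp_all add: lam_coeff_def fls_mat_eval_def mat_eval_def)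

lemma lam_coeff_fls_mat_eval_inject:
  assumes carrier: "A \<in> carrier_mat n n" "B \<in> carrier_mat n n"
  shows "(\<forall>p x. lam_coeff p (fls_mat_eval A x) = lam_coeff p (fls_mat_eval B x)) \<longleftrightarrow> A = B"
proof
  assume "\<forall>p x. lam_coeff p (fls_mat_eval A x) = lam_coeff p (fls_mat_eval B x)"
  then have "mat_coeff (- p) A = mat_coeff (- p) B" for p
    using carrier by (simp add: lam_coeff_fls_mat_eval flip: mat_eval_inject[of _ n])
  then have coeff: "mat_coeff m A = mat_coeff m B" for m by (metis minus_minus)
  show "A = B"
  proof (rule eq_matI)
    fix i k assume "i < dim_row B" "k < dim_col B"
    then show "A $$ (i, k) = B $$ (i, k)"
      using arg_cong[OF coeff, of "\<lambda>A. A $$ (i, k)"] carrier by (intro fls_eqI) simp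
  qed (use carrier in auto)
qed simp

lemma fls_mat_eval_lax_mat:
  assumes "u \<in> carrier_mat n n"
  shows "fls_mat_eval (lax_mat n u) x = J_mat n + map_mat fls_const (mat_eval u x)"
  using assms
  by (intro eq_matI)
    (auto simp: fls_mat_eval_def mat_eval_def lax_mat_def spectral_V_def J_mat_def lam_def
      b_mat_def elem_mat_def fls_eval.hom_add fls_map_const fls_map_X_inv)

lemma lam_coeff_fls_mat_eval_covariant_deriv:
  assumes A: "A \<in> carrier_mat n n" and Z: "Z \<in> carrier_mat n n"
  shows "lam_coeff p (fls_mat_eval (covariant_deriv A Z) x)
    = mat_deriv n (\<lambda>y. lam_coeff p (fls_mat_eval Z y)) x
      + lam_coeff p (commutator (fls_mat_eval A x) (fls_mat_eval Z x))"
proof -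
  have coeff_Z: "mat_coeff (- p) Z \<in> carrier_mat n n" using Z by simp
  have "map_mat \<partial> (mat_coeff (- p) Z) = mat_coeff (- p) (map_mat \<partial> Z)"
    using Z by (intro eq_matI) auto
  then have "mat_deriv n (\<lambda>y. lam_coeff p (fls_mat_eval Z y)) x
      = mat_eval (mat_coeff (- p) (map_mat \<partial> Z)) x"
    using mat_deriv_mat_eval[OF coeff_Z] by (simp add: lam_coeff_fls_mat_eval)
  moreover have "commutator (fls_mat_eval A x) (fls_mat_eval Z x) = fls_mat_eval (commutator A Z) x"
    using map_mat_commutator[OF fls_eval.comm_ring_hom_axioms A Z] by (simp add: fls_mat_eval_def)
  moreover have "mat_eval (mat_coeff (- p) (covariant_deriv A Z)) x
      = mat_eval (mat_coeff (- p) (map_mat \<partial> Z)) x + mat_eval (mat_coeff (- p) (commutator A Z)) x"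
    using A Z unfolding covariant_deriv_def commutator_def mat_eval_def
    by (intro eq_matI) (auto simp: smooth_eval.hom_add simp del: index_mult_mat(1))
  ultimately show ?thesis by (simp add: lam_coeff_fls_mat_eval)
qed

lemma fls_mat_eval_pow: "A \<in> carrier_mat n n \<Longrightarrow> fls_mat_eval (A ^\<^sub>m j) x = fls_mat_eval A x ^\<^sub>m j"
  unfolding fls_mat_eval_def by (rule fls_eval.mat_hom_pow)

lemma fls_mat_eval_lam_one: "fls_mat_eval (fls_X_inv \<cdot>\<^sub>m 1\<^sub>m n) x = lam \<cdot>\<^sub>m 1\<^sub>m n"
  by (rule eq_matI) (auto simp: fls_mat_eval_def lam_def fls_map_X_inv)

lemma exists_fls_mat_eval:
  assumes Y: "\<And>x. Y x \<in> carrier_mat n n"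
    and high: "\<And>p x. p > 1 \<Longrightarrow> lam_coeff p (Y x) = 0\<^sub>m n n"
    and smooth: "\<And>p. smooth_mat n (\<lambda>x. lam_coeff p (Y x))"
  obtains S where "S \<in> carrier_mat n n" "Y = fls_mat_eval S"
proof -
  define S where "S = mat n n (\<lambda>(i, k). Abs_fls (\<lambda>m. Smooth (\<lambda>x. fls_nth (Y x $$ (i, k)) m)))"
  have S: "S \<in> carrier_mat n n" by (simp add: S_def)
  have S_index: "smooth_eval (fls_nth (S $$ (i, k)) m) = (\<lambda>x. fls_nth (Y x $$ (i, k)) m)"
    if ik: "i < n" "k < n" for i k m
  proof -
    have "smooth_fun (\<lambda>x. lam_coeff (- m) (Y x) $$ (i, k))"
      using smooth[of "- m"] ik by (simp add: smooth_mat_def)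
    then have smooth_coeff: "smooth_fun (\<lambda>x. fls_nth (Y x $$ (i, k)) m)"
      by (simp add: lam_coeff_index[OF Y ik])
    have "fls_nth (Y x $$ (i, k)) m = 0" if "m < - 1" for x m
      using arg_cong[OF high[of "- m" x], of "\<lambda>A. A $$ (i, k)"] that ik
      by (simp add: lam_coeff_index[OF Y ik])
    then have "Smooth (\<lambda>x. fls_nth (Y x $$ (i, k)) m) = 0" if "m < - 1" for m
      using that by (simp add: zero_smooth_real_def)
    then have "fls_nth (S $$ (i, k)) m = Smooth (\<lambda>x. fls_nth (Y x $$ (i, k)) m)"
      using ik by (simp add: S_def nth_Abs_fls_lower_bound[of "- 1"])
    then show ?thesis by (simp add: smooth_eval_Smooth[OF smooth_coeff])
  qed
  have "Y x = fls_mat_eval S x" for x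
  proof (rule eq_matI)
    fix i k assume "i < dim_row (fls_mat_eval S x)" "k < dim_col (fls_mat_eval S x)"
    then have "i < n" "k < n" using S by (auto simp: fls_mat_eval_def)
    then show "Y x $$ (i, k) = fls_mat_eval S x $$ (i, k)"
      using S S_index by (intro fls_eqI) (simp add: fls_mat_eval_def)
  qed (use Y[of x] S in \<open>auto simp: fls_mat_eval_def\<close>)
  then show ?thesis using that S by blast
qed

lemma has_J_leading_iff_lam_coeff:
  assumes Y: "Y \<in> carrier_mat n n"
  shows "has_J_leading n Y \<longleftrightarrow> (\<forall>p x. p > 1 \<longrightarrow> lam_coeff p (fls_mat_eval Y x) = 0\<^sub>m n n) \<and>
    (\<forall>x. lam_coeff 1 (fls_mat_eval Y x) = elem_mat n 0 (n - 1))"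
proof -
  have coeff: "mat_coeff m Y \<in> carrier_mat n n" for m using Y by simp
  have zero: "mat_eval (0\<^sub>m n n) x = 0\<^sub>m n n"
    and elem: "mat_eval (elem_mat n i k) x = elem_mat n i k" for x i k
    by (rule eq_matI; simp add: mat_eval_def elem_mat_index)+
  have "(\<forall>x. lam_coeff p (fls_mat_eval Y x) = 0\<^sub>m n n)
      \<longleftrightarrow> (\<forall>i<n. \<forall>k<n. fls_nth (Y $$ (i, k)) (- p) = 0)" for p
    using mat_eval_inject[OF coeff zero_carrier_mat, of "- p"] Y
    by (simp add: lam_coeff_fls_mat_eval zero mat_eq_iff)
  then have "(\<forall>p x. p > 1 \<longrightarrow> lam_coeff p (fls_mat_eval Y x) = 0\<^sub>m n n)
      \<longleftrightarrow> (\<forall>p. - p < - 1 \<longrightarrow> (\<forall>i<n. \<forall>k<n. fls_nth (Y $$ (i, k)) (- p) = 0))"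
    by auto
  also have "\<dots> \<longleftrightarrow> (\<forall>m. m < - 1 \<longrightarrow> (\<forall>i<n. \<forall>k<n. fls_nth (Y $$ (i, k)) m = 0))"
    by (metis minus_minus)
  finally have high: "(\<forall>p x. p > 1 \<longrightarrow> lam_coeff p (fls_mat_eval Y x) = 0\<^sub>m n n) \<longleftrightarrow> \<dots>" .
  have "(\<forall>x. lam_coeff 1 (fls_mat_eval Y x) = elem_mat n 0 (n - 1)) \<longleftrightarrow>
    (\<forall>i<n. \<forall>k<n. fls_nth (Y $$ (i, k)) (- 1) = elem_mat n 0 (n - 1) $$ (i, k))"
    using mat_eval_inject[OF coeff elem_mat_carrier, of "- 1" 0 "n - 1"] Y
    by (simp add: lam_coeff_fls_mat_eval elem mat_eq_iff)
  then show ?thesis unfolding has_J_leading_def high using Y by blast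
qed

lemma mat_trace_eq_0_iff_lam_coeff:
  assumes Y: "Y \<in> carrier_mat n n"
  shows "mat_trace Y = 0 \<longleftrightarrow> (\<forall>p x. (\<Sum>k<n. lam_coeff p (fls_mat_eval Y x) $$ (k, k)) = 0)"
proof -
  have "(\<Sum>k<n. lam_coeff p (fls_mat_eval Y x) $$ (k, k))
      = smooth_eval (fls_nth (mat_trace Y) (- p)) x" for p x
    using Y
    by (simp add: lam_coeff_fls_mat_eval mat_eval_def mat_trace_def fls_nth_sum smooth_eval.hom_sum)
  moreover have "f = 0" if f: "\<forall>p x. smooth_eval (fls_nth f (- p)) x = 0" for f
  proof (intro fls_eqI smooth_eqI)
    show "smooth_eval (fls_nth f m) x = smooth_eval (fls_nth 0 m) x" for m x
      using f[rule_format, of "- m" x] by simp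
  qed
  ultimately show ?thesis by auto
qed

lemma is_Y_series_fls_mat_eval:
  assumes u: "u \<in> carrier_mat n n" and Y: "Y \<in> carrier_mat n n"
  shows "is_Y_series n (mat_eval u) (fls_mat_eval Y) \<longleftrightarrow> is_lax_root n u Y \<and> mat_trace Y = 0"
proof -
  have lax: "lax_mat n u \<in> carrier_mat n n" using u by simp
  have smooth: "smooth_mat n (\<lambda>x. lam_coeff p (fls_mat_eval Y x))" for p
    unfolding smooth_mat_iff lam_coeff_fls_mat_eval
    using Y by (intro bexI[of _ "mat_coeff (- p) Y"]) auto
  have zero: "lam_coeff p (fls_mat_eval (0\<^sub>m n n) x) = 0\<^sub>m n n" for p x
    by (rule eq_matI) (simp_all add: lam_coeff_fls_mat_eval mat_eval_def)
  have deriv: "(\<forall>p x. mat_deriv n (\<lambda>y. lam_coeff p (fls_mat_eval Y y)) x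
      + lam_coeff p (commutator (J_mat n + map_mat fls_const (mat_eval u x)) (fls_mat_eval Y x))
      = 0\<^sub>m n n)
    \<longleftrightarrow> covariant_deriv (lax_mat n u) Y = 0\<^sub>m n n"
    using lam_coeff_fls_mat_eval_inject[OF covariant_deriv_carrier[OF lax Y] zero_carrier_mat]
    by (simp add: lam_coeff_fls_mat_eval_covariant_deriv[OF lax Y] zero fls_mat_eval_lax_mat[OF u])
  have pow: "(\<forall>x. fls_mat_eval Y x ^\<^sub>m n = lam \<cdot>\<^sub>m 1\<^sub>m n) \<longleftrightarrow> Y ^\<^sub>m n = fls_X_inv \<cdot>\<^sub>m 1\<^sub>m n"
  proof
    assume "\<forall>x. fls_mat_eval Y x ^\<^sub>m n = lam \<cdot>\<^sub>m 1\<^sub>m n"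
    then have "fls_mat_eval (Y ^\<^sub>m n) x = fls_mat_eval (fls_X_inv \<cdot>\<^sub>m 1\<^sub>m n) x" for x
      by (simp add: fls_mat_eval_pow[OF Y] fls_mat_eval_lam_one)
    then show "Y ^\<^sub>m n = fls_X_inv \<cdot>\<^sub>m 1\<^sub>m n"
      using lam_coeff_fls_mat_eval_inject[of "Y ^\<^sub>m n" n "fls_X_inv \<cdot>\<^sub>m 1\<^sub>m n"] Y by simp
  qed (simp add: fls_mat_eval_lam_one flip: fls_mat_eval_pow[OF Y])
  show ?thesis
    unfolding is_Y_series_def is_lax_root_def has_J_leading_iff_lam_coeff[OF Y]
      mat_trace_eq_0_iff_lam_coeff[OF Y] deriv pow
    using smooth Y by auto
qed

lemma Y_series_mat_eval:
  assumes n: "n \<ge> 2" and u: "u \<in> V_mats n" and Y: "is_lax_root n u Y"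
  shows "Y_series n (mat_eval u) = fls_mat_eval Y"
  unfolding Y_series_def
proof (rule the_equality)
  have unit: "of_nat n dvd (1 :: smooth_real)" using n by (intro of_nat_smooth_real_dvd_1) simp
  note is_Y_series_iff = is_Y_series_fls_mat_eval[OF V_mats_carrier[OF u]]
  have Y_carrier: "Y \<in> carrier_mat n n" using Y by (rule is_lax_root_carrier)
  have "mat_trace (Y ^\<^sub>m 1) = 0"
    using n by (intro mat_trace_lax_root_pow[OF surj_derivation_smooth_real unit n u Y]) auto
  then have "mat_trace Y = 0" using Y_carrier by simp
  then show "is_Y_series n (mat_eval u) (fls_mat_eval Y)"
    using is_Y_series_iff[OF Y_carrier] Y by simp
  fix Y' assume Y': "is_Y_series n (mat_eval u) Y'"
  then obtain S where S: "S \<in> carrier_mat n n" "Y' = fls_mat_eval S"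
    using exists_fls_mat_eval[of Y' n] unfolding is_Y_series_def by metis
  then have "is_lax_root n u S" using is_Y_series_iff Y' by blast
  then have "S = Y" using ex1_lax_root[OF surj_derivation_smooth_real unit n u] Y by blast
  then show "Y' = fls_mat_eval Y" using S by simp
qed

lemma Y_coeff_mat_eval:
  assumes n: "n \<ge> 2" and u: "u \<in> V_mats n" and Y: "is_lax_root n u Y"
  shows "Y_coeff n j p (mat_eval u) = mat_eval (mat_coeff (- p) (Y ^\<^sub>m j))"
proof
  show "Y_coeff n j p (mat_eval u) x = mat_eval (mat_coeff (- p) (Y ^\<^sub>m j)) x" for x
    by (simp add: Y_coeff_def Y_series_mat_eval[OF assms] lam_coeff_fls_mat_eval
        flip: fls_mat_eval_pow[OF is_lax_root_carrier[OF Y]])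
qed

lemma exists_Y_coeff_0_mat_eval:
  assumes n: "n \<ge> 2" and u: "u \<in> V_mats n" and j: "\<not> n dvd j"
  obtains A where "A \<in> carrier_mat n n" "Y_coeff n j 0 (mat_eval u) = mat_eval A" "mat_trace A = 0"
    "\<And>i k. k < i \<Longrightarrow> i < n \<Longrightarrow> covariant_deriv (b_mat n + u) A $$ (i, k) = 0"
proof -
  have unit: "of_nat n dvd (1 :: smooth_real)" using n by (intro of_nat_smooth_real_dvd_1) simp
  obtain Y where Y: "is_lax_root n u Y"
    using ex1_lax_root[OF surj_derivation_smooth_real unit n u] by blast
  have Y_carrier: "Y \<in> carrier_mat n n" "Y ^\<^sub>m j \<in> carrier_mat n n"
    using is_lax_root_carrier[OF Y] by simp_all
  have u_carrier: "u \<in> carrier_mat n n" using u by (rule V_mats_carrier)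
  have "intertwines (lax_mat n u) (lax_mat n u) (Y ^\<^sub>m j)"
    using is_lax_root_intertwines[OF Y u_carrier] Y_carrier(1) u_carrier
    by (intro intertwines_pow) simp_all
  then have below: "covariant_deriv (b_mat n + u) (mat_coeff 0 (Y ^\<^sub>m j)) $$ (i, k) = 0"
    if "k < i" "i < n" for i k
    using that by (intro covariant_deriv_coeff_0_below[OF n u Y_carrier(2)])
  have "mat_trace (mat_coeff 0 (Y ^\<^sub>m j)) = fls_nth (mat_trace (Y ^\<^sub>m j)) 0"
    using Y_carrier by (simp add: mat_trace_def fls_nth_sum carrier_matD[OF Y_carrier(1)])
  then have trace: "mat_trace (mat_coeff 0 (Y ^\<^sub>m j)) = 0"
    using mat_trace_lax_root_pow[OF surj_derivation_smooth_real unit n u Y j] by simp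
  have "Y_coeff n j 0 (mat_eval u) = mat_eval (mat_coeff 0 (Y ^\<^sub>m j))"
    using Y_coeff_mat_eval[OF n u Y, of j 0] by simp
  then show ?thesis
    using Y_carrier(2) trace below by (intro that[of "mat_coeff 0 (Y ^\<^sub>m j)"]) simp_all
qed

lemma is_zeta_mat_eval:
  assumes u: "u \<in> V_mats n"
    and A: "A \<in> carrier_mat n n" "Y_coeff n j 0 (mat_eval u) = mat_eval A"
    and \<zeta>: "\<zeta> \<in> carrier_mat n n"
  shows "is_zeta n j (mat_eval u) (mat_eval \<zeta>) \<longleftrightarrow>
    \<zeta> \<in> strictly_upper_mats n \<and> covariant_deriv (b_mat n + u) (A - \<zeta>) \<in> V_mats n"
proof -
  have carrier: "u \<in> carrier_mat n n" "b_mat n + u \<in> carrier_mat n n"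
    using V_mats_carrier[OF u] by simp_all
  have diff: "A - \<zeta> \<in> carrier_mat n n" using \<zeta> by (rule minus_carrier_mat)
  have "(\<lambda>y. Y_coeff n j 0 (mat_eval u) y - mat_eval \<zeta> y) = mat_eval (A - \<zeta>)"
    using A \<zeta> by (auto simp: mat_eval_diff)
  moreover have "mat_deriv n (mat_eval (A - \<zeta>)) x
      + commutator (b_mat n + mat_eval u x) (mat_eval (A - \<zeta>) x)
    = mat_eval (covariant_deriv (b_mat n + u) (A - \<zeta>)) x" for x
    by (simp add: mat_eval_covariant_deriv[OF carrier(2) diff] mat_eval_b_mat_add[OF carrier(1)])
  moreover have "smooth_mat n (mat_eval \<zeta>)" unfolding smooth_mat_iff using \<zeta> by blast
  ultimately show ?thesis
    unfolding is_zeta_def V_space_eq_V_mats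
    using mat_eval_strictly_upper_iff[OF \<zeta>]
      mat_eval_in_V_mats_iff[OF covariant_deriv_carrier[OF carrier(2) diff]] A \<zeta>
    by (simp add: mat_eval_diff)
qed

lemma Z0_mat_eval:
  assumes n: "n \<ge> 2" and u: "u \<in> V_mats n" and j: "\<not> n dvd j"
  obtains Z where "Z \<in> carrier_mat n n" "Z0 n j (mat_eval u) = mat_eval Z"
    "covariant_deriv (b_mat n + u) Z \<in> V_mats n" "mat_trace Z = 0"
proof -
  have n_pos: "n > 0" using n by simp
  obtain A where A: "A \<in> carrier_mat n n" "Y_coeff n j 0 (mat_eval u) = mat_eval A"
    and trace: "mat_trace A = 0"
    and below: "\<And>i k. k < i \<Longrightarrow> i < n \<Longrightarrow> covariant_deriv (b_mat n + u) A $$ (i, k) = 0"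
    using exists_Y_coeff_0_mat_eval[OF n u j] by blast
  have ex1: "\<exists>!\<zeta>. \<zeta> \<in> strictly_upper_mats n \<and> covariant_deriv (b_mat n + u) (A - \<zeta>) \<in> V_mats n"
    by (rule ex1_strictly_upper_correction[OF u n_pos A(1) below trace])
  then obtain \<zeta> where \<zeta>: "\<zeta> \<in> strictly_upper_mats n"
    "covariant_deriv (b_mat n + u) (A - \<zeta>) \<in> V_mats n" by blast
  have \<zeta>_carrier: "\<zeta> \<in> carrier_mat n n" using \<zeta>(1) by (simp add: strictly_upper_mats_def)
  have "zeta n j (mat_eval u) = mat_eval \<zeta>"
    unfolding zeta_def
  proof (rule the_equality)
    show "is_zeta n j (mat_eval u) (mat_eval \<zeta>)" using is_zeta_mat_eval[OF u A \<zeta>_carrier] \<zeta> by simp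
    fix \<zeta>' assume \<zeta>': "is_zeta n j (mat_eval u) \<zeta>'"
    then obtain S where S: "S \<in> carrier_mat n n" "\<zeta>' = mat_eval S"
      unfolding is_zeta_def smooth_mat_iff by blast
    then have "S = \<zeta>" using is_zeta_mat_eval[OF u A S(1)] \<zeta>' \<zeta> ex1 by blast
    then show "\<zeta>' = mat_eval \<zeta>" using S by simp
  qed
  then have "Z0 n j (mat_eval u) = mat_eval (A - \<zeta>)"
    using A \<zeta>_carrier by (auto simp: Z0_def mat_eval_diff)
  moreover have "mat_trace (A - \<zeta>) = mat_trace A"
    using A(1) \<zeta>(1) by (simp add: mat_trace_def strictly_upper_mats_def carrier_matD[OF \<zeta>_carrier])
  moreover have "A - \<zeta> \<in> carrier_mat n n" using \<zeta>_carrier by (rule minus_carrier_mat)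
  ultimately show ?thesis using that \<zeta>(2) trace by metis
qed


section \<open>Central affine curves\<close>

lemma dim_vec_deriv [simp]: "dim_vec (vec_deriv n k X x) = n"
  by (simp add: vec_deriv_def)

lemma vec_deriv_smooth_eval:
  assumes "\<And>i. i < n \<Longrightarrow> (\<lambda>x. X x $ i) = smooth_eval (c i)" "i < n"
  shows "vec_deriv n k X x $ i = smooth_eval ((\<partial> ^^ k) (c i)) x"
  using assms by (simp add: vec_deriv_def smooth_eval_funpow_derivation)

lemma smooth_vecE:
  assumes "smooth_vec n X"
  obtains c where "\<And>i. i < n \<Longrightarrow> (\<lambda>x. X x $ i) = smooth_eval (c i)"
proof -
  have "(\<lambda>x. X x $ i) = smooth_eval (Smooth (\<lambda>x. X x $ i))" if "i < n" for i
    using assms that by (simp add: smooth_vec_def smooth_eval_Smooth)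
  then show ?thesis by (rule that)
qed

lemma frame_eq_mat_eval_wronskian_mat:
  assumes "\<And>i. i < n \<Longrightarrow> (\<lambda>x. \<gamma> x $ i) = smooth_eval (c i)"
  shows "frame n \<gamma> x = mat_eval (wronskian_mat n c) x"
  by (rule eq_matI)
    (simp_all add: frame_def frame_cols_def mat_of_cols_def mat_eval_def wronskian_mat_index
      vec_deriv_smooth_eval[OF assms])

lemma central_affine_curvature_eq_mat_eval:
  fixes c :: "nat \<Rightarrow> smooth_real"
  assumes n: "n > 0" and c: "\<And>i. i < n \<Longrightarrow> (\<lambda>x. \<gamma> x $ i) = smooth_eval (c i)"
    and det: "det (wronskian_mat n c) = 1" and u: "u \<in> V_mats n"
    and frame: "map_mat \<partial> (wronskian_mat n c) = wronskian_mat n c * (b_mat n + u)"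
  shows "central_affine_curvature n \<gamma> = mat_eval u"
proof
  fix x
  let ?G = "mat_eval (wronskian_mat n c) x"
  have G: "?G \<in> carrier_mat n n" "det ?G = 1" using det by (simp_all add: det_mat_eval)
  have eval_u: "mat_eval u x \<in> V_mats n" using mat_eval_in_V_mats_iff[OF V_mats_carrier[OF u]] u by blast
  have G_index: "?G $$ (r, i) = vec_deriv n i \<gamma> x $ r" if "r < n" "i < n" for r i
    using that
    by (simp add: mat_eval_index[OF wronskian_mat_carrier] wronskian_mat_index
        vec_deriv_smooth_eval[OF c])
  have combination:
    "(\<Sum>i<n - 1. v $$ (i, n - 1) * vec_deriv n i \<gamma> x $ r) = (?G * v) $$ (r, n - 1)"
    if v: "v \<in> V_mats n" and r: "r < n" for v r
    unfolding mult_V_mats_last_index[OF v G(1) r n]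
    using r by (intro sum.cong) (simp_all add: G_index)
  have top: "vec_deriv n n \<gamma> x $ r = (?G * mat_eval u x) $$ (r, n - 1)" if r: "r < n" for r
    using r n V_mats_carrier[OF u]
    by (simp add: vec_deriv_smooth_eval[OF c] wronskian_mat_top_derivative[OF n u r frame]
        mat_eval_index[OF mult_carrier_mat[OF wronskian_mat_carrier]]
        flip: mat_eval_mult[OF wronskian_mat_carrier] del: index_mult_mat(1))
  show "central_affine_curvature n \<gamma> x = mat_eval u x"
    unfolding central_affine_curvature_def V_space_eq_V_mats
  proof (rule the_equality)
    show "mat_eval u x \<in> V_mats n \<and> (\<forall>r<n. vec_deriv n n \<gamma> x $ r
        = (\<Sum>i<n - 1. mat_eval u x $$ (i, n - 1) * vec_deriv n i \<gamma> x $ r))"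
      using eval_u combination[OF eval_u] top by simp
    fix v assume v: "v \<in> V_mats n \<and> (\<forall>r<n. vec_deriv n n \<gamma> x $ r
        = (\<Sum>i<n - 1. v $$ (i, n - 1) * vec_deriv n i \<gamma> x $ r))"
    then have "(?G * v) $$ (r, n - 1) = (?G * mat_eval u x) $$ (r, n - 1)" if "r < n" for r
      using that combination[of v r] top[of r] by simp
    then show "v = mat_eval u x" using v eval_u by (intro V_mats_eqI[OF G]) simp_all
  qed
qed

lemma mat_of_cols_frame_cols_update:
  assumes "i < n" "v \<in> carrier_vec n"
  shows "mat_of_cols n ((frame_cols n \<gamma> x)[i := v]) = replace_col (frame n \<gamma> x) v i"
  using assms by (intro eq_matI)
    (auto simp: replace_col_def frame_def frame_cols_def mat_of_cols_def nth_list_update)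

lemma mult_mat_vec_unit_vec:
  fixes A :: "'a::comm_ring_1 mat"
  assumes "A \<in> carrier_mat m n" "i < n"
  shows "A *\<^sub>v unit_vec n i = col A i"
  using assms by (intro eq_vecI) auto

lemma tangent_at_wronskian_mat:
  fixes c :: "nat \<Rightarrow> smooth_real"
  assumes n: "n > 0" and c: "\<And>i. i < n \<Longrightarrow> (\<lambda>x. \<gamma> x $ i) = smooth_eval (c i)"
    and Z: "Z \<in> carrier_mat n n" "mat_trace Z = 0"
    and WZ: "wronskian_mat n c * Z = wronskian_mat n d"
  shows "tangent_at n \<gamma> (\<lambda>x. frame n \<gamma> x *\<^sub>v (mat_eval Z x *\<^sub>v unit_vec n 0))"
proof -
  define X where "X x = frame n \<gamma> x *\<^sub>v (mat_eval Z x *\<^sub>v unit_vec n 0)" for x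
  have frame: "frame n \<gamma> x = mat_eval (wronskian_mat n c) x" for x
    by (rule frame_eq_mat_eval_wronskian_mat[OF c])
  have carrier: "frame n \<gamma> x \<in> carrier_mat n n" "mat_eval Z x \<in> carrier_mat n n"
      "mat_eval (wronskian_mat n d) x \<in> carrier_mat n n" for x
    using Z(1) by (simp_all add: frame)
  have frame_mult: "frame n \<gamma> x * mat_eval Z x = mat_eval (wronskian_mat n d) x" for x
    by (simp add: frame WZ flip: mat_eval_mult[OF wronskian_mat_carrier Z(1)])
  have "X x = col (mat_eval (wronskian_mat n d) x) 0" for x
    using assoc_mult_mat_vec[OF carrier(1,2) unit_vec_carrier, of x x 0]
      mult_mat_vec_unit_vec[OF carrier(3) n]
    by (simp add: X_def frame_mult)
  then have X: "X x \<in> carrier_vec n" "i < n \<Longrightarrow> (\<lambda>x. X x $ i) = smooth_eval (d i)" for x i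
    using n by (auto simp: mat_eval_def wronskian_mat_index carrier_vecI)
  then have "smooth_vec n X" by (simp add: smooth_vec_def)
  moreover have "vec_deriv n i X x = col (frame n \<gamma> x * mat_eval Z x) i" if "i < n" for i x
    using that unfolding frame_mult
    by (intro eq_vecI)
      (auto simp: vec_deriv_smooth_eval[OF X(2)] wronskian_mat_index mat_eval_def)
  then have "(\<Sum>i<n. det (mat_of_cols n ((frame_cols n \<gamma> x)[i := vec_deriv n i X x])))
      = (\<Sum>i<n. det (replace_col (frame n \<gamma> x) (col (frame n \<gamma> x * mat_eval Z x) i) i))" for x
    by (intro sum.cong)
      (simp_all add: mat_of_cols_frame_cols_update carrier_vecI carrier_matD[OF carrier(1)])
  then have "(\<Sum>i<n. det (mat_of_cols n ((frame_cols n \<gamma> x)[i := vec_deriv n i X x]))) = 0" for x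
    by (simp add: sum_det_replace_col_mult[OF carrier(1,2)] mat_trace_mat_eval[OF Z(1)] Z(2))
  ultimately show ?thesis unfolding tangent_at_def X_def[abs_def] by blast
qed

lemma tangent_at_curve_flow_field:
  assumes n: "n \<ge> 2" and j: "\<not> n dvd j" and \<gamma>: "\<gamma> \<in> central_affine_curves n"
  shows "tangent_at n \<gamma> (curve_flow_field n j \<gamma>)"
proof -
  have n_pos: "n > 0" using n by simp
  obtain c where c: "\<And>i. i < n \<Longrightarrow> (\<lambda>x. \<gamma> x $ i) = smooth_eval (c i)"
    using \<gamma> smooth_vecE[of n \<gamma>] by (auto simp: central_affine_curves_def)
  have det: "det (wronskian_mat n c) = 1"
    using \<gamma> frame_eq_mat_eval_wronskian_mat[of n \<gamma> c, OF c]
    by (intro smooth_eqI) (simp add: central_affine_curves_def flip: det_mat_eval)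
  obtain u where u: "u \<in> V_mats n"
    and frame: "map_mat \<partial> (wronskian_mat n c) = wronskian_mat n c * (b_mat n + u)"
    using frame_equation[OF n_pos det] by blast
  obtain Z where Z: "Z \<in> carrier_mat n n" "Z0 n j (mat_eval u) = mat_eval Z"
      "covariant_deriv (b_mat n + u) Z \<in> V_mats n" "mat_trace Z = 0"
    using Z0_mat_eval[OF n u j] by blast
  have "central_affine_curvature n \<gamma> = mat_eval u"
    by (rule central_affine_curvature_eq_mat_eval[OF n_pos c det u frame])
  moreover have "tangent_at n \<gamma> (\<lambda>x. frame n \<gamma> x *\<^sub>v (mat_eval Z x *\<^sub>v unit_vec n 0))"
    by (rule tangent_at_wronskian_mat[OF n_pos c Z(1,4)
          frame_mult_eq_wronskian_mat[OF wronskian_mat_carrier Z(1) u frame Z(3)]])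
  ultimately show ?thesis by (simp add: curve_flow_field_def Z(2))
qed

theorem corollary2p5:
  fixes n j :: nat and \<gamma> :: "real \<Rightarrow> real vec"
    and g u :: "real \<Rightarrow> real mat"
  assumes "n \<ge> 2" and "j \<ge> 1" and "j mod n \<noteq> 0"
    and "\<gamma> \<in> central_affine_curves n"
    and "g = frame n \<gamma>" and "u = central_affine_curvature n \<gamma>"
  shows "tangent_at n \<gamma> (\<lambda>x. g x *\<^sub>v (Z0 n j u x *\<^sub>v unit_vec n 0))
    \<and> flow_equation n (curve_flow_field n j)"
proof -
  have "\<not> n dvd j" using \<open>j mod n \<noteq> 0\<close> by (simp add: dvd_eq_mod_eq_0)
  then have tangent: "tangent_at n \<gamma>' (curve_flow_field n j \<gamma>')"
    if "\<gamma>' \<in> central_affine_curves n" for \<gamma>'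
    using tangent_at_curve_flow_field[OF \<open>n \<ge> 2\<close>] that by blast
  have "(\<lambda>x. g x *\<^sub>v (Z0 n j u x *\<^sub>v unit_vec n 0)) = curve_flow_field n j \<gamma>"
    by (simp add: curve_flow_field_def assms(5,6))
  then show ?thesis
    using tangent \<open>\<gamma> \<in> central_affine_curves n\<close> by (simp add: flow_equation_def)
qed

end
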